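(* There is an absolute constant $c > 0$ such that the following holds for every nonnegative integer $n$. Let $\mathcal{F} \subseteq 2^{[n]}$ be a union-closed family with $\mathcal{F} \neq \{\emptyset\}$ and $|\mathcal{F}| \geq \left(\frac{1}{2} - c\right) 2^n$. Then there is some element $i \in [n]$ such that $|\mathcal{F}_i| \geq \frac{1}{2}|\mathcal{F}|$.
   Context: Here $[n] = \{1,\dots,n\}$ and $2^{[n]}$ is the family of all subsets of $[n]$. A family $\mathcal{F} \subseteq 2^{[n]}$ is called union-closed if for every two sets $A, B \in \mathcal{F}$ we have $A \cup B \in \mathcal{F}$. For $i \in [n]$, $\mathcal{F}_i := \{A \in \mathcal{F} : i \in A\}$. *)

theory Defs
  imports Complex_Main
begin

definition union_closed :: "'a set set \<Rightarrow> bool" where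
  "union_closed F \<longleftrightarrow> (\<forall>A\<in>F. \<forall>B\<in>F. A \<union> B \<in> F)"

definition members_containing :: "'a set set \<Rightarrow> 'a \<Rightarrow> 'a set set" where
  "members_containing F i = {A \<in> F. i \<in> A}"

end

theory Submission
  imports Defs "HOL-Analysis.Convex"
begin

text \<open>
  Suppose that every element lies in fewer than half of the members, and let \<open>f\<close> be the sign
  function of \<open>F\<close>, so that all level-one Fourier coefficients of \<open>f\<close> are positive. As \<open>F\<close> is
  union-closed, a non-member covers at most one member, which bounds the upward edge boundary by
  the number of non-members. In Fourier terms, total influence plus the sum of the level-one
  coefficients is at most \<open>2 + O(c)\<close>, and it is at least \<open>2 - O(c)\<close> plus the weight above level
  two. So nearly all weight sits on levels at most two. By a fourth-moment bound this forces all
  influence outside a set \<open>J\<close> of at most 48 coordinates to be \<open>O(c)\<close>, and \<open>F\<close> is close to the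
  lift of the majority family \<open>H\<close> on \<open>J\<close>. For small \<open>c\<close>, integrality makes \<open>H\<close> exactly
  extremal: it is union-closed, contains half of all subsets of \<open>J\<close>, and every non-member covers
  a member. Such families consist of the sets meeting \<open>T\<close> in a number of elements different
  from one, where \<open>T\<close> has one or two elements. Finally, edge isoperimetry for the small set of
  exceptions shows that, averaged over the elements outside \<open>T\<close>, a family close to such an
  extremal one has at least half frequency, which contradicts strictness.
\<close>

section \<open>Edge boundaries in the cube\<close>

text \<open>An edge in direction \<open>i\<close> is represented by its lower endpoint. These are
  the edges leaving \<open>F\<close> upward; applied to \<open>- F\<close>, the definition gives the
  edges entering \<open>F\<close>.\<close>

definition up_boundary :: "'a set \<Rightarrow> 'a set set \<Rightarrow> 'a \<Rightarrow> 'a set set" where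
  "up_boundary X F i = {A \<in> Pow (X - {i}). A \<in> F \<and> insert i A \<notin> F}"

definition edge_boundary :: "'a set \<Rightarrow> 'a set set \<Rightarrow> 'a \<Rightarrow> 'a set set" where
  "edge_boundary X F i = {A \<in> Pow (X - {i}). (A \<in> F) \<noteq> (insert i A \<in> F)}"

lemma finite_up_boundary [simp]: "finite X \<Longrightarrow> finite (up_boundary X F i)"
  unfolding up_boundary_def by simp

lemma finite_edge_boundary [simp]: "finite X \<Longrightarrow> finite (edge_boundary X F i)"
  unfolding edge_boundary_def by simp

lemma card_edge_boundary: "finite X \<Longrightarrow> card (edge_boundary X F i) = card (up_boundary X F i) + card (up_boundary X (- F) i)"
proof -
  assume "finite X"
  have "edge_boundary X F i = up_boundary X F i \<union> up_boundary X (- F) i" "up_boundary X F i \<inter> up_boundary X (- F) i = {}"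
    unfolding edge_boundary_def up_boundary_def by auto
  then show ?thesis using \<open>finite X\<close> by (simp add: card_Un_disjoint)
qed

lemma sum_Pow_insert:
  fixes h :: "'a set \<Rightarrow> 'b :: comm_monoid_add"
  assumes "finite X" "x \<notin> X"
  shows "(\<Sum>A\<in>Pow (insert x X). h A) = (\<Sum>A\<in>Pow X. h A + h (insert x A))"
proof -
  have "inj_on (insert x) (Pow X)" using assms by (auto simp: inj_on_def)
  moreover have "Pow X \<inter> insert x ` Pow X = {}" using assms by auto
  ultimately show ?thesis using assms
    by (simp add: Pow_insert sum.union_disjoint sum.reindex sum.distrib)
qed

lemma sum_Pow_Un:
  fixes h :: "'a set \<Rightarrow> 'b :: comm_monoid_add"
  assumes "J \<subseteq> X"
  shows "(\<Sum>A\<in>Pow X. h A) = (\<Sum>u\<in>Pow J. \<Sum>y\<in>Pow (X - J). h (u \<union> y))"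
proof -
  have "(\<Sum>u\<in>Pow J. \<Sum>y\<in>Pow (X - J). h (u \<union> y)) = (\<Sum>(u, y)\<in>Pow J \<times> Pow (X - J). h (u \<union> y))"
    by (simp add: sum.cartesian_product)
  also have "\<dots> = (\<Sum>A\<in>Pow X. h A)"
    by (rule sum.reindex_bij_witness[where i = "\<lambda>A. (A \<inter> J, A - J)" and j = "\<lambda>(u, y). u \<union> y"])
      (use assms in auto)
  finally show ?thesis ..
qed

section \<open>Edge isoperimetry on the cube\<close>

text \<open>Both \<open>a * log 2 (a + b)\<close> and \<open>b * log 2 (a + b)\<close> gain at least
  \<open>a\<close>: the first because \<open>a + b \<ge> 2 * a\<close>, the second because
  \<open>log 2 (1 + x) \<ge> x\<close> on the unit interval, at \<open>x = a / b\<close>. The total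
  \<open>2 * a\<close> is the difference of \<open>a + b\<close> and \<open>b - a\<close>, as the
  induction for \<open>edge_isoperimetric_log\<close> needs.\<close>

lemma xlogx_superadditive:
  fixes a b :: real
  assumes "0 \<le> a" "a \<le> b"
  shows "a * log 2 a + b * log 2 b + 2 * a \<le> (a + b) * log 2 (a + b)"
proof (cases "a = 0")
  case False
  then have a: "a > 0" "b > 0" using assms by auto
  have 1: "log 2 (a + b) \<ge> 1 + log 2 a"
  proof -
    have "1 + log 2 a = log 2 (2 * a)" using a by (simp add: log_mult)
    also have "\<dots> \<le> log 2 (a + b)" using a assms by simp
    finally show ?thesis .
  qed
  have 2: "b * log 2 (a + b) \<ge> b * log 2 b + a"
  proof -
    have "2 powr (a / b) * 1 powr (1 - a / b) \<le> (a / b) * 2 + (1 - a / b) * 1"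
      using a assms by (intro Youngs_inequality_0) auto
    also have "\<dots> = (a + b) / b" using a by (simp add: field_simps)
    finally have "2 powr (a / b) \<le> (a + b) / b" by simp
    then have "a / b \<le> log 2 ((a + b) / b)" using a by (simp add: le_log_iff)
    also have "\<dots> = log 2 (a + b) - log 2 b" using a by (simp add: log_divide)
    finally show ?thesis using a by (simp add: field_simps)
  qed
  have "a * log 2 (a + b) \<ge> a * (1 + log 2 a)"
    using 1 a by (intro mult_left_mono) auto
  then show ?thesis using 2 by (simp add: algebra_simps)
qed (use assms in auto)

text \<open>The cube splits along \<open>x\<close> into two halves. Edges inside the halves are
  bounded by induction, and the edges in direction \<open>x\<close> number at least the difference
  of the two half sizes.\<close>

lemma edge_isoperimetric_log:
  assumes "finite X"
  shows "real (card (B \<inter> Pow X)) * (real (card X) - log 2 (card (B \<inter> Pow X)))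
    \<le> (\<Sum>i\<in>X. real (card (edge_boundary X B i)))"
  using assms
proof (induction X arbitrary: B rule: finite_induct)
  case empty
  have "card (B \<inter> {{}}) \<le> 1" by (cases "{} \<in> B") auto
  then consider "card (B \<inter> {{}}) = 0" | "card (B \<inter> {{}}) = 1" by linarith
  then show ?case by cases auto
next
  case (insert x X)
  \<comment> \<open>On \<open>Pow X\<close> this is the upper half of \<open>B\<close> with
    \<open>x\<close> removed, so that both halves live on the same cube.\<close>
  define B1 where "B1 = {A. insert x A \<in> B}"
  define b0 where "b0 = card (B \<inter> Pow X)"
  define b1 where "b1 = card (B1 \<inter> Pow X)"
  define n where "n = real (card X)"
  have inj: "inj_on (insert x) S" if "S \<subseteq> Pow X" for S
    using that insert.hyps unfolding inj_on_def by (metis Pow_iff in_mono insert_ident)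
  have "B \<inter> Pow (insert x X) = (B \<inter> Pow X) \<union> insert x ` (B1 \<inter> Pow X)"
    unfolding B1_def by (auto simp: Pow_insert)
  moreover have "(B \<inter> Pow X) \<inter> insert x ` (B1 \<inter> Pow X) = {}" using insert.hyps by auto
  ultimately have cB: "card (B \<inter> Pow (insert x X)) = b0 + b1"
    using insert.hyps inj[of "B1 \<inter> Pow X"]
    by (simp add: card_Un_disjoint card_image b0_def b1_def)
  have bdx: "\<bar>real b1 - real b0\<bar> \<le> card (edge_boundary (insert x X) B x)"
  proof -
    have "edge_boundary (insert x X) B x = (B \<inter> Pow X - B1) \<union> (B1 \<inter> Pow X - B)"
      using insert.hyps unfolding edge_boundary_def B1_def by auto
    moreover have "card (B \<inter> Pow X) \<le> card ((B \<inter> Pow X - B1) \<union> (B1 \<inter> Pow X - B) \<union> (B1 \<inter> Pow X))"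
      using insert.hyps by (intro card_mono) auto
    moreover have "card (B1 \<inter> Pow X) \<le> card ((B \<inter> Pow X - B1) \<union> (B1 \<inter> Pow X - B) \<union> (B \<inter> Pow X))"
      using insert.hyps by (intro card_mono) auto
    ultimately show ?thesis unfolding b0_def b1_def
      using card_Un_le[of "(B \<inter> Pow X - B1) \<union> (B1 \<inter> Pow X - B)" "B1 \<inter> Pow X"]
        card_Un_le[of "(B \<inter> Pow X - B1) \<union> (B1 \<inter> Pow X - B)" "B \<inter> Pow X"]
      by simp
  qed
  have bdi: "real (card (edge_boundary (insert x X) B i)) = card (edge_boundary X B i) + card (edge_boundary X B1 i)" if "i \<in> X" for i
  proof -
    have ne: "i \<noteq> x" using that insert.hyps by auto
    have "edge_boundary (insert x X) B i = edge_boundary X B i \<union> insert x ` edge_boundary X B1 i"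
    proof -
      have *: "insert x X - {i} = insert x (X - {i})" using ne by auto
      show ?thesis
        unfolding edge_boundary_def B1_def * Pow_insert by (auto simp: insert_commute)
    qed
    moreover have "edge_boundary X B i \<inter> insert x ` edge_boundary X B1 i = {}"
      using insert.hyps unfolding edge_boundary_def by auto
    moreover have "card (insert x ` edge_boundary X B1 i) = card (edge_boundary X B1 i)"
      by (intro card_image inj) (auto simp: edge_boundary_def)
    ultimately show ?thesis using insert.hyps by (simp add: card_Un_disjoint)
  qed
  have "b0 * (n - log 2 b0) + b1 * (n - log 2 b1) + \<bar>real b1 - real b0\<bar>
    \<le> (\<Sum>i\<in>insert x X. real (card (edge_boundary (insert x X) B i)))"
    using insert.IH[of B] insert.IH[of B1] bdx insert.hyps
    by (simp add: bdi sum.distrib b0_def b1_def n_def)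
  moreover have "(real b0 + real b1) * (n + 1 - log 2 (real b0 + real b1))
    \<le> b0 * (n - log 2 b0) + b1 * (n - log 2 b1) + \<bar>real b1 - real b0\<bar>"
  proof (cases "b0 \<le> b1")
    case True
    then show ?thesis using xlogx_superadditive[of "real b0" "real b1"] by (simp add: algebra_simps)
  next
    case False
    then show ?thesis using xlogx_superadditive[of "real b1" "real b0"] by (simp add: algebra_simps)
  qed
  ultimately show ?case unfolding cB using insert.hyps by (simp add: n_def add.commute)
qed

lemma edge_isoperimetric:
  assumes "finite X" "2 ^ k * card (B \<inter> Pow X) \<le> 2 ^ card X"
  shows "k * card (B \<inter> Pow X) \<le> (\<Sum>i\<in>X. card (edge_boundary X B i))"
proof (cases "card (B \<inter> Pow X) = 0")
  case False
  define b where "b = real (card (B \<inter> Pow X))"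
  have b: "b > 0" using False by (simp add: b_def)
  have "real (2 ^ k * card (B \<inter> Pow X)) \<le> real (2 ^ card X)"
    using assms(2) of_nat_mono by blast
  then have "2 ^ k * b \<le> 2 ^ card X" by (simp add: b_def)
  then have "log 2 (2 ^ k * b) \<le> log 2 (2 ^ card X)" using b by (intro log_mono) auto
  then have "real k \<le> card X - log 2 b" using b by (simp add: log_mult log_nat_power)
  then have "b * k \<le> b * (card X - log 2 b)" using b by (intro mult_left_mono) auto
  also have "\<dots> \<le> (\<Sum>i\<in>X. real (card (edge_boundary X B i)))"
    using edge_isoperimetric_log[OF assms(1), of B] by (simp add: b_def)
  finally have "real (k * card (B \<inter> Pow X)) \<le> real (\<Sum>i\<in>X. card (edge_boundary X B i))"
    by (simp add: b_def mult.commute)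
  then show ?thesis using of_nat_le_iff by blast
qed auto

text \<open>\<open>B\<close> and its complement have the same boundary edges, and the smaller of
  them has density at most one half, so isoperimetry with \<open>k = 1\<close> applies to
  it.\<close>

lemma min_card_le_boundary:
  assumes "finite X"
  shows "min (card (B \<inter> Pow X)) (2 ^ card X - card (B \<inter> Pow X)) \<le> (\<Sum>i\<in>X. card (edge_boundary X B i))"
proof -
  have "card (Pow X) = card (B \<inter> Pow X) + card (- B \<inter> Pow X)"
  proof -
    have "Pow X = (B \<inter> Pow X) \<union> (- B \<inter> Pow X)" by auto
    then show ?thesis using assms card_Un_disjoint[of "B \<inter> Pow X" "- B \<inter> Pow X"] by auto
  qed
  then have c: "2 ^ card X = card (B \<inter> Pow X) + card (- B \<inter> Pow X)"
    using assms by (simp add: card_Pow)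
  have "edge_boundary X (- B) i = edge_boundary X B i" for i by (auto simp: edge_boundary_def)
  then show ?thesis
    using edge_isoperimetric[OF assms, of 1 B] edge_isoperimetric[OF assms, of 1 "- B"] c
    by (cases "card (B \<inter> Pow X) \<le> card (- B \<inter> Pow X)") auto
qed

section \<open>Upward boundaries of union-closed families\<close>

text \<open>If a non-member covered two members, it would be their union.\<close>

lemma inj_on_insert_up_boundary:
  assumes "union_closed F"
  shows "inj_on (\<lambda>(i, A). insert i A) (SIGMA i:Y. up_boundary X F i)"
proof (rule inj_onI, clarify)
  fix i A j B
  assume *: "A \<in> up_boundary X F i" "B \<in> up_boundary X F j" "insert i A = insert j B"
  have "i = j"
  proof (rule ccontr)
    assume "i \<noteq> j"
    then have "insert i A = A \<union> B" using * unfolding up_boundary_def by blast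
    then show False using * assms unfolding up_boundary_def union_closed_def by auto
  qed
  then show "i = j \<and> A = B" using * unfolding up_boundary_def by blast
qed

text \<open>Each edge leaving \<open>F\<close> is charged to its upper endpoint, a non-member, and
  no non-member is charged twice.\<close>

lemma sum_card_up_boundary_le:
  assumes "finite X" "union_closed F"
  shows "(\<Sum>i\<in>X. card (up_boundary X F i)) \<le> card (Pow X - F)"
proof -
  have "(\<Sum>i\<in>X. card (up_boundary X F i)) = card (SIGMA i:X. up_boundary X F i)"
    using assms by simp
  also have "\<dots> \<le> card (Pow X - F)"
  proof (rule card_inj_on_le)
    show "inj_on (\<lambda>(i, A). insert i A) (SIGMA i:X. up_boundary X F i)"
      using assms(2) by (rule inj_on_insert_up_boundary)
  qed (use assms in \<open>auto simp: up_boundary_def\<close>)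
  finally show ?thesis .
qed

text \<open>
  Fix \<open>i\<close> with \<open>u - {i} \<in> H\<close> for a non-member \<open>u\<close>. Then
  no \<open>y \<in> H\<close> satisfies \<open>i \<in> y \<subseteq> u\<close>, as its union with
  \<open>u - {i}\<close> would be \<open>u\<close>. In particular \<open>{i}\<close> is a
  non-member, and a two-element non-member would have to cover a singleton member; so
  \<open>u\<close> contains exactly one non-member singleton.
\<close>

lemma exact_structure:
  assumes fin: "finite J" and uc: "union_closed H"
    and cov: "\<And>u. u \<subseteq> J \<Longrightarrow> u \<notin> H \<Longrightarrow> \<exists>i\<in>u. u - {i} \<in> H"
    and half: "2 * card (Pow J - H) = 2 ^ card J"
  shows "\<exists>T\<subseteq>J. T \<noteq> {} \<and> card T \<le> 2 \<and> (\<forall>u\<subseteq>J. u \<notin> H \<longrightarrow> card (u \<inter> T) = 1)"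
proof -
  define T where "T = {i \<in> J. {i} \<notin> H}"
  have TJ: "T \<subseteq> J" by (auto simp: T_def)
  have one: "\<exists>i. u \<inter> T = {i}" if u: "u \<subseteq> J" "u \<notin> H" for u
  proof -
    obtain i where i: "i \<in> u" "u - {i} \<in> H" using cov u by blast
    have below: "y \<notin> H" if "i \<in> y" "y \<subseteq> u" for y
    proof
      assume "y \<in> H"
      moreover have "y \<union> (u - {i}) = u" using that by auto
      ultimately show False using uc i u unfolding union_closed_def by metis
    qed
    have "i \<in> T" using below[of "{i}"] i u by (auto simp: T_def)
    moreover have "k = i" if k: "k \<in> u \<inter> T" for k
    proof (rule ccontr)
      assume ne: "k \<noteq> i"
      have "{i, k} \<notin> H" using below[of "{i, k}"] k i by auto
      then obtain j where j: "j \<in> {i, k}" "{i, k} - {j} \<in> H"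
        using cov[of "{i, k}"] k i u by blast
      moreover have "{i, k} - {j} = {i} \<or> {i, k} - {j} = {k}" using ne j(1) by blast
      moreover have "{i} \<notin> H" "{k} \<notin> H" using k \<open>i \<in> T\<close> unfolding T_def by blast+
      ultimately show False by metis
    qed
    ultimately show ?thesis using i by blast
  qed
  \<comment> \<open>A non-member is given by its single element of \<open>T\<close> and its part
    outside \<open>T\<close>, so non-members have density at most
    \<open>card T / 2 ^ card T\<close>. Density one half then forces
    \<open>2 ^ card T \<le> 2 * card T\<close>, which fails from three elements on.\<close>
  have "Pow J - H \<subseteq> (\<lambda>(i, y). insert i y) ` (T \<times> Pow (J - T))"
  proof
    fix u assume "u \<in> Pow J - H"
    then have "u \<subseteq> J" "u \<notin> H" by auto
    then obtain i where "u \<inter> T = {i}" using one by metis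
    then have "u = insert i (u - T)" "i \<in> T" "u - T \<subseteq> J - T" using \<open>u \<subseteq> J\<close> by blast+
    then show "u \<in> (\<lambda>(i, y). insert i y) ` (T \<times> Pow (J - T))"
      by (metis (mono_tags, lifting) Pow_iff SigmaI case_prod_conv image_eqI)
  qed
  then have "card (Pow J - H) \<le> card (T \<times> Pow (J - T))"
    using fin TJ by (intro surj_card_le) (auto intro: finite_subset)
  also have "\<dots> = card T * 2 ^ card (J - T)"
    using fin TJ by (simp add: card_cartesian_product card_Pow finite_subset)
  finally have le: "2 ^ card J \<le> 2 * (card T * 2 ^ card (J - T))" using half by linarith
  have "card J = card T + card (J - T)"
    using fin TJ by (metis card_Diff_subset card_mono finite_subset le_add_diff_inverse)
  then have "2 ^ card T \<le> 2 * card T" using le by (simp add: power_add)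
  have "card T \<le> 2"
  proof (rule ccontr)
    assume "\<not> card T \<le> 2"
    then obtain m where m: "card T = m + 3" by (metis add.commute le_add_diff_inverse not_less_eq_eq numeral_2_eq_2 numeral_3_eq_3)
    have "4 * (m + 1) \<le> (4::nat) * 2 ^ m" by (induction m) auto
    then show False using \<open>2 ^ card T \<le> 2 * card T\<close> unfolding m by (simp add: power_add)
  qed
  moreover have "T \<noteq> {}"
  proof
    assume "T = {}"
    then have "Pow J - H = {}" using one by blast
    then show False using half by (metis card.empty mult_0_right power_not_zero zero_neq_numeral)
  qed
  ultimately show ?thesis using TJ one by (metis One_nat_def card.empty card_insert_disjoint empty_iff finite.emptyI)
qed

text \<open>
  The set \<open>B\<close> of exceptional non-members is so small that its edge boundary, most of
  which points outside \<open>T\<close>, is at least \<open>8 * card B\<close>. A non-member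
  \<open>A\<close> with \<open>card (A \<inter> T) = 1\<close> reached by an edge outside
  \<open>T\<close> covers no second member, so \<open>A - T\<close> lies in \<open>B\<close>;
  hence all outgoing edges together number at most \<open>3 * card B\<close>.
\<close>

lemma up_boundary_le_down_boundary_near_extremal:
  assumes fin: "finite X" and uc: "union_closed F" and TX: "T \<subseteq> X" and T2: "card T \<le> 2"
    and small: "2 ^ 8 * card {A \<in> Pow X. card (A \<inter> T) \<noteq> 1 \<and> A \<notin> F} \<le> 2 ^ card X"
  shows "(\<Sum>i\<in>X - T. card (up_boundary X F i)) \<le> (\<Sum>i\<in>X - T. card (up_boundary X (- F) i))"
proof -
  define B where "B = {A \<in> Pow X. card (A \<inter> T) \<noteq> 1 \<and> A \<notin> F}"
  have finB: "finite B" and finT: "finite T" using fin TX by (auto simp: B_def intro: finite_subset)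
  have BX: "B \<inter> Pow X = B" by (auto simp: B_def)
  have up: "(\<Sum>i\<in>X - T. card (up_boundary X F i)) \<le> 3 * card B"
  proof -
    let ?W = "B \<union> (\<lambda>(t, z). insert t z) ` (T \<times> B)"
    have "(\<Sum>i\<in>X - T. card (up_boundary X F i)) = card (SIGMA i:X - T. up_boundary X F i)"
      using fin by simp
    also have "\<dots> \<le> card ?W"
    proof (rule card_inj_on_le)
      show "inj_on (\<lambda>(i, A). insert i A) (SIGMA i:X - T. up_boundary X F i)"
        using uc by (rule inj_on_insert_up_boundary)
      show "(\<lambda>(i, A). insert i A) ` (SIGMA i:X - T. up_boundary X F i) \<subseteq> ?W"
      proof clarify
        fix i A assume i: "i \<in> X" "i \<notin> T" and A: "A \<in> up_boundary X F i"
          and notin: "insert i A \<notin> (\<lambda>(t, z). insert t z) ` (T \<times> B)"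
        show "insert i A \<in> B"
        proof (rule ccontr)
          assume "insert i A \<notin> B"
          then have "card (insert i A \<inter> T) = 1" using A i by (auto simp: B_def up_boundary_def)
          then obtain t where t: "insert i A \<inter> T = {t}" by (auto simp: card_1_singleton_iff)
          define z where "z = insert i A - {t}"
          have "z \<notin> F"
          proof
            assume "z \<in> F"
            moreover have "z \<union> A = insert i A" using t i by (auto simp: z_def)
            ultimately show False using A uc unfolding up_boundary_def union_closed_def by (metis (lifting) mem_Collect_eq)
          qed
          moreover have "z \<inter> T = {}" "z \<subseteq> X" using t A i by (auto simp: z_def up_boundary_def)
          ultimately have "z \<in> B" by (auto simp: B_def)
          moreover have "insert i A = insert t z" "t \<in> T" using t by (auto simp: z_def)
          ultimately show False using notin by (metis (mono_tags, lifting) SigmaI case_prod_conv image_eqI)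
        qed
      qed
    qed (use finB finT in auto)
    also have "\<dots> \<le> card B + card T * card B"
      using card_Un_le[of B "(\<lambda>(t, z). insert t z) ` (T \<times> B)"]
        card_image_le[of "T \<times> B" "\<lambda>(t, z). insert t z"] finB finT
      by (simp add: card_cartesian_product)
    also have "\<dots> \<le> card B + 2 * card B" using T2 by simp
    finally show ?thesis by simp
  qed
  \<comment> \<open>In a fixed direction, each boundary edge of \<open>B\<close> is determined by
    its unique endpoint in \<open>B\<close>.\<close>
  have inT: "card (edge_boundary X B i) \<le> card B" if "i \<in> T" for i
  proof (rule card_inj_on_le)
    show "inj_on (\<lambda>A. if A \<in> B then A else insert i A) (edge_boundary X B i)"
      unfolding inj_on_def edge_boundary_def by (auto split: if_splits)
    show "(\<lambda>A. if A \<in> B then A else insert i A) ` edge_boundary X B i \<subseteq> B"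
      unfolding edge_boundary_def by auto
  qed (rule finB)
  \<comment> \<open>A direction outside \<open>T\<close> keeps \<open>A \<inter> T\<close>, so along
    it a set of \<open>B\<close> can leave \<open>B\<close> only by entering
    \<open>F\<close>.\<close>
  have outT: "card (edge_boundary X B i) \<le> card (edge_boundary X F i)" if "i \<in> X - T" for i
  proof (rule card_mono)
    have "insert i A \<inter> T = A \<inter> T" for A using that by auto
    then show "edge_boundary X B i \<subseteq> edge_boundary X F i"
      using that unfolding edge_boundary_def B_def by auto
  qed (use fin in simp)
  \<comment> \<open>The factor 8 is \<open>2 + 2 * 3\<close>: directions in \<open>T\<close> absorb
    at most \<open>2 * card B\<close> edges, so at least \<open>6 * card B\<close> boundary edges of
    \<open>F\<close> point outside \<open>T\<close>. At most \<open>3 * card B\<close> of them leave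
    \<open>F\<close>, hence at least as many enter it.\<close>
  have "8 * card B \<le> (\<Sum>i\<in>X. card (edge_boundary X B i))"
    using edge_isoperimetric[OF fin, of 8 B] small unfolding BX by (simp add: B_def)
  also have "\<dots> = (\<Sum>i\<in>T. card (edge_boundary X B i)) + (\<Sum>i\<in>X - T. card (edge_boundary X B i))"
    using fin TX by (metis add.commute sum.subset_diff)
  also have "\<dots> \<le> card T * card B + (\<Sum>i\<in>X - T. card (edge_boundary X F i))"
  proof (rule add_mono)
    show "(\<Sum>i\<in>T. card (edge_boundary X B i)) \<le> card T * card B"
      using sum_bounded_above[of T "\<lambda>i. card (edge_boundary X B i)" "card B"] inT by simp
  qed (use outT in \<open>rule sum_mono\<close>)
  also have "\<dots> \<le> 2 * card B + (\<Sum>i\<in>X - T. card (edge_boundary X F i))" using T2 by simp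
  finally have "6 * card B \<le> (\<Sum>i\<in>X - T. card (up_boundary X F i)) + (\<Sum>i\<in>X - T. card (up_boundary X (- F) i))"
    using fin by (simp add: card_edge_boundary sum.distrib)
  then show ?thesis using up by linarith
qed

section \<open>Fourier analysis on the cube\<close>

definition walsh :: "'a set \<Rightarrow> 'a set \<Rightarrow> real" where
  "walsh S A = (- 1) ^ card (S \<inter> A)"

definition fourier :: "'a set \<Rightarrow> ('a set \<Rightarrow> real) \<Rightarrow> 'a set \<Rightarrow> real" where
  "fourier X f S = (\<Sum>A\<in>Pow X. f A * walsh S A) / 2 ^ card X"

definition toggle :: "'a \<Rightarrow> 'a set \<Rightarrow> 'a set" where
  "toggle i A = (if i \<in> A then A - {i} else insert i A)"

text \<open>The part of \<open>f\<close> that is odd in direction \<open>i\<close>: it keeps exactly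
  the Walsh terms with \<open>i \<in> S\<close>. For a sign function its values are -1, 0 and
  1.\<close>

definition laplacian :: "'a \<Rightarrow> ('a set \<Rightarrow> real) \<Rightarrow> 'a set \<Rightarrow> real" where
  "laplacian i f A = (f A - f (toggle i A)) / 2"

text \<open>With this orientation, a positive coefficient at \<open>{i}\<close> means that
  \<open>i\<close> lies in fewer than half of the members.\<close>

definition sign :: "'a set set \<Rightarrow> 'a set \<Rightarrow> real" where
  "sign F A = (if A \<in> F then 1 else - 1)"

section \<open>Walsh characters and Parseval\<close>

lemma walsh_commute: "walsh S A = walsh A S"
  by (simp add: walsh_def Int_commute)

lemma walsh_empty [simp]: "walsh {} A = 1"
  by (simp add: walsh_def)

lemma walsh_squared [simp]: "(walsh S A)\<^sup>2 = 1"
  by (simp add: walsh_def flip: power_mult)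

lemma walsh_singleton: "walsh {i} A = (if i \<in> A then - 1 else 1)"
  by (simp add: walsh_def)

lemma walsh_insert:
  assumes "finite A" "x \<notin> A"
  shows "walsh S (insert x A) = (if x \<in> S then - walsh S A else walsh S A)"
  using assms by (simp add: walsh_def Int_insert_right)

lemma walsh_mult:
  assumes "finite S"
  shows "walsh A S * walsh B S = walsh (sym_diff A B) S"
proof -
  have "card (A \<inter> S) = card ((A - B) \<inter> S) + card (A \<inter> B \<inter> S)"
    using assms by (subst card_Un_disjoint[symmetric]) (auto intro: arg_cong[where f = card])
  moreover have "card (B \<inter> S) = card ((B - A) \<inter> S) + card (A \<inter> B \<inter> S)"
    using assms by (subst card_Un_disjoint[symmetric]) (auto intro: arg_cong[where f = card])
  moreover have "card (sym_diff A B \<inter> S) = card ((A - B) \<inter> S) + card ((B - A) \<inter> S)"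
    using assms by (subst card_Un_disjoint[symmetric]) (auto intro: arg_cong[where f = card])
  ultimately have "card (A \<inter> S) + card (B \<inter> S) = card (sym_diff A B \<inter> S) + 2 * card (A \<inter> B \<inter> S)"
    by simp
  then show ?thesis unfolding walsh_def by (simp add: power_mult flip: power_add) (simp add: power_add power_mult)
qed

lemma sum_walsh:
  assumes "finite X"
  shows "(\<Sum>A\<in>Pow X. walsh S A) = (if S \<inter> X = {} then 2 ^ card X else 0)"
  using assms
proof (induction X rule: finite_induct)
  case empty
  then show ?case by (simp add: walsh_def)
next
  case (insert x X)
  have "(\<Sum>A\<in>Pow (insert x X). walsh S A) = (\<Sum>A\<in>Pow X. (if x \<in> S then 0 else 2 * walsh S A))"
    unfolding sum_Pow_insert[OF insert.hyps]
  proof (intro sum.cong refl)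
    fix A assume "A \<in> Pow X"
    then have "finite A" "x \<notin> A" using insert.hyps by (auto intro: finite_subset)
    then show "walsh S A + walsh S (insert x A) = (if x \<in> S then 0 else 2 * walsh S A)"
      by (simp add: walsh_insert)
  qed
  then show ?case using insert by (cases "x \<in> S") (simp_all flip: sum_distrib_left)
qed

lemma parseval:
  assumes "finite X"
  shows "(\<Sum>S\<in>Pow X. (fourier X f S)\<^sup>2) = (\<Sum>A\<in>Pow X. (f A)\<^sup>2) / 2 ^ card X"
proof -
  have orth: "(\<Sum>S\<in>Pow X. walsh S A * walsh S B) = (if A = B then 2 ^ card X else 0)"
    if "A \<in> Pow X" "B \<in> Pow X" for A B
  proof -
    have "(\<Sum>S\<in>Pow X. walsh S A * walsh S B) = (\<Sum>S\<in>Pow X. walsh (sym_diff A B) S)"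
      using assms by (intro sum.cong) (auto simp: walsh_mult finite_subset walsh_commute[of _ A] walsh_commute[of _ B])
    also have "\<dots> = (if A = B then 2 ^ card X else 0)"
      unfolding sum_walsh[OF assms] using that by (auto simp: Int_absorb2)
    finally show ?thesis .
  qed
  have "(\<Sum>S\<in>Pow X. (\<Sum>A\<in>Pow X. f A * walsh S A)\<^sup>2)
    = (\<Sum>S\<in>Pow X. \<Sum>A\<in>Pow X. \<Sum>B\<in>Pow X. f A * f B * (walsh S A * walsh S B))"
    by (simp add: power2_eq_square sum_product algebra_simps)
  also have "\<dots> = (\<Sum>A\<in>Pow X. \<Sum>S\<in>Pow X. \<Sum>B\<in>Pow X. f A * f B * (walsh S A * walsh S B))"
    by (rule sum.swap)
  also have "\<dots> = (\<Sum>A\<in>Pow X. \<Sum>B\<in>Pow X. \<Sum>S\<in>Pow X. f A * f B * (walsh S A * walsh S B))"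
    by (intro sum.cong refl sum.swap)
  also have "\<dots> = (\<Sum>A\<in>Pow X. \<Sum>B\<in>Pow X. f A * f B * (if A = B then 2 ^ card X else 0))"
    by (intro sum.cong refl) (simp add: orth flip: sum_distrib_left)
  also have "\<dots> = (\<Sum>A\<in>Pow X. (f A)\<^sup>2 * 2 ^ card X)"
    using assms by (intro sum.cong refl) (simp add: if_distrib[of "(*) _"] sum.delta' power2_eq_square cong: if_cong)
  finally have "(\<Sum>S\<in>Pow X. (\<Sum>A\<in>Pow X. f A * walsh S A)\<^sup>2) = (\<Sum>A\<in>Pow X. (f A)\<^sup>2) * 2 ^ card X"
    by (simp add: sum_distrib_right)
  moreover have "(\<Sum>S\<in>Pow X. (fourier X f S)\<^sup>2)
    = (\<Sum>S\<in>Pow X. (\<Sum>A\<in>Pow X. f A * walsh S A)\<^sup>2) / (2 ^ card X)\<^sup>2"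
    by (simp add: fourier_def power_divide flip: sum_divide_distrib)
  ultimately show ?thesis by (simp add: power2_eq_square)
qed

lemma toggle_toggle [simp]: "toggle i (toggle i A) = A"
  by (auto simp: toggle_def)

lemma toggle_Pow: "i \<in> X \<Longrightarrow> toggle i A \<in> Pow X \<longleftrightarrow> A \<in> Pow X"
  by (auto simp: toggle_def)

lemma walsh_toggle:
  assumes "finite A"
  shows "walsh S (toggle i A) = (if i \<in> S then - walsh S A else walsh S A)"
proof (cases "i \<in> A")
  case True
  then show ?thesis using walsh_insert[of "A - {i}" i S] assms by (auto simp: toggle_def insert_absorb)
qed (use assms in \<open>simp add: toggle_def walsh_insert\<close>)

section \<open>Influences and level-one coefficients\<close>

lemma fourier_laplacian:
  assumes "finite X" "i \<in> X"
  shows "fourier X (laplacian i f) S = (if i \<in> S then fourier X f S else 0)"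
proof -
  have "(\<Sum>A\<in>Pow X. f (toggle i A) * walsh S A) = (\<Sum>A\<in>Pow X. f A * walsh S (toggle i A))"
    using assms by (intro sum.reindex_bij_witness[where i = "toggle i" and j = "toggle i"])
      (simp_all add: toggle_Pow del: Pow_iff)
  also have "\<dots> = (\<Sum>A\<in>Pow X. (if i \<in> S then - 1 else 1) * (f A * walsh S A))"
    using assms by (intro sum.cong) (auto simp: walsh_toggle finite_subset)
  also have "\<dots> = (if i \<in> S then - 1 else 1) * (\<Sum>A\<in>Pow X. f A * walsh S A)"
    by (simp only: sum_distrib_left)
  finally have "(\<Sum>A\<in>Pow X. laplacian i f A * walsh S A)
    = ((\<Sum>A\<in>Pow X. f A * walsh S A) - (if i \<in> S then - 1 else 1) * (\<Sum>A\<in>Pow X. f A * walsh S A)) / 2"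
    by (simp add: laplacian_def left_diff_distrib sum_subtractf flip: sum_divide_distrib)
  then show ?thesis by (cases "i \<in> S") (simp_all add: fourier_def)
qed

lemma sum_laplacian_sign_squared:
  assumes "finite X" "i \<in> X"
  shows "(\<Sum>A\<in>Pow X. (laplacian i (sign F) A)\<^sup>2) = 2 * card (edge_boundary X F i)"
proof -
  define Y where "Y = X - {i}"
  have Y: "finite Y" "i \<notin> Y" "X = insert i Y" using assms by (auto simp: Y_def)
  have "(\<Sum>A\<in>Pow X. (laplacian i (sign F) A)\<^sup>2) = (\<Sum>A\<in>Pow Y. 2 * (if (A \<in> F) \<noteq> (insert i A \<in> F) then 1 else 0))"
    unfolding Y(3) sum_Pow_insert[OF Y(1,2)]
  proof (rule sum.cong)
    fix A assume "A \<in> Pow Y"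
    then have "i \<notin> A" using Y by auto
    then show "(laplacian i (sign F) A)\<^sup>2 + (laplacian i (sign F) (insert i A))\<^sup>2
      = 2 * (if (A \<in> F) \<noteq> (insert i A \<in> F) then 1 else 0)"
      by (auto simp: laplacian_def toggle_def sign_def)
  qed simp
  also have "\<dots> = 2 * card (edge_boundary X F i)"
    using Y(1) unfolding edge_boundary_def Y_def[symmetric]
    by (simp add: sum.If_cases flip: sum_distrib_left) (auto intro: arg_cong[where f = card])
  finally show ?thesis .
qed

text \<open>Parseval for \<open>laplacian i (sign F)\<close>, whose square is 1 at both endpoints of
  a boundary edge and 0 elsewhere; hence the factor 2.\<close>

lemma influence_fourier:
  assumes "finite X" "i \<in> X"
  shows "2 * card (edge_boundary X F i) / 2 ^ card X = (\<Sum>S\<in>{S \<in> Pow X. i \<in> S}. (fourier X (sign F) S)\<^sup>2)"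
proof -
  have "2 * card (edge_boundary X F i) / 2 ^ card X = (\<Sum>S\<in>Pow X. (fourier X (laplacian i (sign F)) S)\<^sup>2)"
    using assms by (simp add: parseval sum_laplacian_sign_squared)
  also have "\<dots> = (\<Sum>S\<in>Pow X. if i \<in> S then (fourier X (sign F) S)\<^sup>2 else 0)"
    using assms by (intro sum.cong) (simp_all add: fourier_laplacian)
  also have "\<dots> = (\<Sum>S\<in>{S \<in> Pow X. i \<in> S}. (fourier X (sign F) S)\<^sup>2)"
    using assms by (simp add: sum.inter_filter del: Pow_iff)
  finally show ?thesis .
qed

text \<open>When \<open>A\<close> is paired with \<open>insert i A\<close>, only boundary edges
  contribute: 2 for an edge leaving \<open>F\<close> upward and -2 for an edge entering it.\<close>

lemma fourier_singleton:
  assumes "finite X" "i \<in> X"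
  shows "fourier X (sign F) {i} = 2 * (real (card (up_boundary X F i)) - real (card (up_boundary X (- F) i))) / 2 ^ card X"
proof -
  define Y where "Y = X - {i}"
  have Y: "finite Y" "i \<notin> Y" "X = insert i Y" using assms by (auto simp: Y_def)
  have "(\<Sum>A\<in>Pow X. sign F A * walsh {i} A)
    = (\<Sum>A\<in>Pow Y. 2 * (if A \<in> F \<and> insert i A \<notin> F then 1 else 0) - 2 * (if A \<notin> F \<and> insert i A \<in> F then 1 else 0))"
    unfolding Y(3) sum_Pow_insert[OF Y(1,2)]
  proof (rule sum.cong)
    fix A assume "A \<in> Pow Y"
    then have "i \<notin> A" using Y by auto
    then show "sign F A * walsh {i} A + sign F (insert i A) * walsh {i} (insert i A)
      = 2 * (if A \<in> F \<and> insert i A \<notin> F then 1 else 0) - 2 * (if A \<notin> F \<and> insert i A \<in> F then 1 else 0)"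
      by (auto simp: walsh_singleton sign_def)
  qed simp
  also have "\<dots> = 2 * real (card (up_boundary X F i)) - 2 * real (card (up_boundary X (- F) i))"
  proof -
    have "up_boundary X F i = Pow Y \<inter> {A. A \<in> F \<and> insert i A \<notin> F}"
      "up_boundary X (- F) i = Pow Y \<inter> {A. A \<notin> F \<and> insert i A \<in> F}"
      by (auto simp: up_boundary_def Y_def)
    then show ?thesis using Y(1)
      by (simp add: sum_subtractf sum.If_cases flip: sum_distrib_left)
  qed
  finally show ?thesis by (simp add: fourier_def right_diff_distrib)
qed

section \<open>Fourth moments and the level inequality\<close>

text \<open>Hypercontractivity in degree one. A new coordinate averages over \<open>a x\<close> and
  \<open>- a x\<close>, which cancels the odd powers.\<close>

lemma fourth_moment_affine:
  fixes a :: "'a \<Rightarrow> real" and c :: real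
  assumes "finite X"
  defines "l \<equiv> \<lambda>X A. c + (\<Sum>j\<in>X. a j * walsh {j} A)"
  shows "(\<Sum>A\<in>Pow X. (l X A)\<^sup>2) = 2 ^ card X * (c\<^sup>2 + (\<Sum>j\<in>X. (a j)\<^sup>2))"
    and "(\<Sum>A\<in>Pow X. (l X A) ^ 4) \<le> 3 * 2 ^ card X * (c\<^sup>2 + (\<Sum>j\<in>X. (a j)\<^sup>2))\<^sup>2"
  using assms(1)
proof (induction X rule: finite_induct)
  case empty
  case 1 show ?case by (simp add: l_def)
  case 2
  have "c ^ 4 \<ge> 0" by simp
  then show ?case by (simp add: l_def flip: power_mult)
next
  case (insert x X)
  have l: "l (insert x X) A = l X A + a x" "l (insert x X) (insert x A) = l X A - a x"
    if "A \<in> Pow X" for A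
  proof -
    have "walsh {j} (insert x A) = walsh {j} A" if "j \<in> X" for j
      using that insert.hyps by (auto simp: walsh_singleton)
    then show "l (insert x X) A = l X A + a x" "l (insert x X) (insert x A) = l X A - a x"
      using that insert.hyps by (auto simp: l_def walsh_singleton)
  qed
  let ?s = "c\<^sup>2 + (\<Sum>j\<in>X. (a j)\<^sup>2)" and ?N = "2 ^ card X :: real"
  have "(\<Sum>A\<in>Pow (insert x X). (l (insert x X) A)\<^sup>2) = (\<Sum>A\<in>Pow X. 2 * (l X A)\<^sup>2 + 2 * (a x)\<^sup>2)"
    unfolding sum_Pow_insert[OF insert.hyps]
    by (intro sum.cong) (auto simp: l power2_eq_square algebra_simps)
  also have "\<dots> = 2 * (?N * ?s) + ?N * (2 * (a x)\<^sup>2)"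
    using insert by (simp add: sum.distrib card_Pow flip: sum_distrib_left)
  also have "\<dots> = 2 ^ card (insert x X) * (c\<^sup>2 + (\<Sum>j\<in>insert x X. (a j)\<^sup>2))"
    using insert.hyps by (simp add: algebra_simps)
  finally show 1: "(\<Sum>A\<in>Pow (insert x X). (l (insert x X) A)\<^sup>2) = \<dots>" .
  have "(\<Sum>A\<in>Pow (insert x X). (l (insert x X) A) ^ 4)
    = (\<Sum>A\<in>Pow X. 2 * (l X A) ^ 4 + 12 * (a x)\<^sup>2 * (l X A)\<^sup>2 + 2 * (a x) ^ 4)"
    unfolding sum_Pow_insert[OF insert.hyps]
    by (intro sum.cong) (auto simp: l power2_eq_square power4_eq_xxxx algebra_simps)
  also have "\<dots> = 2 * (\<Sum>A\<in>Pow X. (l X A) ^ 4) + 12 * (a x)\<^sup>2 * (?N * ?s) + ?N * (2 * (a x) ^ 4)"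
    using insert by (simp add: sum.distrib card_Pow flip: sum_distrib_left)
  \<comment> \<open>Enlarging \<open>2 * (a x) ^ 4\<close> to \<open>6 * (a x) ^ 4\<close> completes
    the square.\<close>
  also have "\<dots> \<le> 2 * (3 * ?N * ?s\<^sup>2) + 12 * (a x)\<^sup>2 * (?N * ?s) + ?N * (6 * (a x) ^ 4)"
    using insert.IH(2) by (intro add_mono mult_left_mono) auto
  also have "\<dots> = 3 * 2 ^ card (insert x X) * (c\<^sup>2 + (\<Sum>j\<in>insert x X. (a j)\<^sup>2))\<^sup>2"
  proof -
    have "2 * (3 * N * s\<^sup>2) + 12 * b\<^sup>2 * (N * s) + N * (6 * b ^ 4) = 3 * (2 * N) * (s + b\<^sup>2)\<^sup>2"
      for N s b :: real by algebra
    then show ?thesis using insert.hyps by (simp add: add.assoc add.commute[of "(a x)\<^sup>2"])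
  qed
  finally show "(\<Sum>A\<in>Pow (insert x X). (l (insert x X) A) ^ 4)
    \<le> 3 * 2 ^ card (insert x X) * (c\<^sup>2 + (\<Sum>j\<in>insert x X. (a j)\<^sup>2))\<^sup>2" .
qed

text \<open>
  A level inequality: a function with values in \<open>{-1, 0, 1}\<close> and small support
  correlates poorly with the affine forms, because their fourth moments are controlled by their
  second moments.
\<close>

lemma low_degree_weight_le:
  fixes F :: "'a set set"
  assumes fin: "finite X" and i: "i \<in> X"
  defines "t \<equiv> 2 * card (edge_boundary X F i) / 2 ^ card X"
  assumes t: "12 * t \<le> 1"
  shows "(\<Sum>S\<in>{S \<in> Pow X. i \<in> S \<and> card S \<le> 2}. (fourier X (sign F) S)\<^sup>2) \<le> t / 2"
proof -
  define K where "K = {S \<in> Pow X. i \<in> S \<and> card S \<le> 2}"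
  define w where "w = fourier X (sign F)"
  define g where "g = laplacian i (sign F)"
  \<comment> \<open>The part of \<open>g\<close> on levels one and two; \<open>N * \<sigma>\<close>
    is its inner product with \<open>g\<close>.\<close>
  define q where "q A = (\<Sum>S\<in>K. w S * walsh S A)" for A
  define \<sigma> where "\<sigma> = (\<Sum>S\<in>K. (w S)\<^sup>2)"
  define N where "N = (2::real) ^ card X"
  \<comment> \<open>The value 0 at \<open>j = i\<close> keeps \<open>{i, i} = {i}\<close> from being
    counted twice and lets the affine form range over all of \<open>X\<close>.\<close>
  define a where "a j = (if j = i then 0 else w {i, j})" for j
  have N: "N > 0" by (simp add: N_def)
  have K: "K = insert {i} ((\<lambda>j. {i, j}) ` (X - {i}))"
  proof
    show "K \<subseteq> insert {i} ((\<lambda>j. {i, j}) ` (X - {i}))"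
    proof
      fix S assume S: "S \<in> K"
      then have "finite S" "card (S - {i}) \<le> 1" using fin by (auto simp: K_def finite_subset)
      then consider "S - {i} = {}" | j where "S - {i} = {j}"
        by (metis card_0_eq card_1_singletonE finite_Diff le_Suc_eq le_zero_eq One_nat_def)
      then show "S \<in> insert {i} ((\<lambda>j. {i, j}) ` (X - {i}))"
      proof cases
        case 1
        then show ?thesis using S by (auto simp: K_def)
      next
        case (2 j)
        then have "S = {i, j}" "j \<in> X - {i}" using S by (auto simp: K_def)
        then show ?thesis by blast
      qed
    qed
    show "insert {i} ((\<lambda>j. {i, j}) ` (X - {i})) \<subseteq> K"
      using i by (auto simp: K_def card_insert_if)
  qed
  have sumK: "(\<Sum>S\<in>K. h S) = h {i} + (\<Sum>j\<in>X - {i}. h {i, j})" for h :: "'a set \<Rightarrow> real"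
  proof -
    have "inj_on (\<lambda>j. {i, j}) (X - {i})" by (auto simp: inj_on_def doubleton_eq_iff)
    moreover have "{i} \<notin> (\<lambda>j. {i, j}) ` (X - {i})" by auto
    ultimately show ?thesis unfolding K using fin by (simp add: sum.reindex)
  qed
  have sa: "(\<Sum>j\<in>X. h (a j) j) = (\<Sum>j\<in>X - {i}. h (w {i, j}) j)"
    if "\<And>j. h 0 j = 0" for h :: "real \<Rightarrow> 'a \<Rightarrow> real"
    using fin i that by (simp add: sum.remove[of X i] a_def)
  have \<sigma>: "\<sigma> = (w {i})\<^sup>2 + (\<Sum>j\<in>X. (a j)\<^sup>2)"
    unfolding \<sigma>_def sumK by (simp add: sa[of "\<lambda>x j. x\<^sup>2"])
  \<comment> \<open>Factoring out \<open>walsh {i}\<close>, which has modulus one, turns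
    \<open>q\<close> into an affine form with the same even moments.\<close>
  have q: "q A = walsh {i} A * (w {i} + (\<Sum>j\<in>X. a j * walsh {j} A))" if "A \<in> Pow X" for A
  proof -
    have "walsh {i, j} A = walsh {i} A * walsh {j} A" if "j \<in> X - {i}" for j
      using that by (auto simp: walsh_def Int_insert_left)
    then show ?thesis unfolding q_def sumK
      by (simp add: sa[of "\<lambda>x j. x * walsh {j} A"] algebra_simps sum_distrib_left)
  qed
  have q4: "(\<Sum>A\<in>Pow X. ((q A)\<^sup>2)\<^sup>2) \<le> 3 * N * \<sigma>\<^sup>2"
  proof -
    have "(\<Sum>A\<in>Pow X. ((q A)\<^sup>2)\<^sup>2) = (\<Sum>A\<in>Pow X. (w {i} + (\<Sum>j\<in>X. a j * walsh {j} A)) ^ 4)"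
    proof (intro sum.cong refl)
      fix A assume "A \<in> Pow X"
      then have "(q A)\<^sup>2 = (w {i} + (\<Sum>j\<in>X. a j * walsh {j} A))\<^sup>2"
        by (simp add: q power_mult_distrib del: Pow_iff)
      then show "((q A)\<^sup>2)\<^sup>2 = (w {i} + (\<Sum>j\<in>X. a j * walsh {j} A)) ^ 4"
        by (simp flip: power_mult)
    qed
    then show ?thesis using fourth_moment_affine(2)[OF fin, of "w {i}" a] by (simp add: \<sigma> N_def)
  qed
  have gg: "(g A)\<^sup>2 * g A = g A" "((g A)\<^sup>2)\<^sup>2 = (g A)\<^sup>2" for A
    by (auto simp: g_def laplacian_def sign_def)
  have g2: "(\<Sum>A\<in>Pow X. (g A)\<^sup>2) = N * t"
    using sum_laplacian_sign_squared[OF fin i, of F] by (simp add: g_def t_def N_def)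
  have gq: "(\<Sum>A\<in>Pow X. g A * q A) = N * \<sigma>"
  proof -
    have "(\<Sum>A\<in>Pow X. g A * q A) = (\<Sum>A\<in>Pow X. \<Sum>S\<in>K. w S * (g A * walsh S A))"
      by (simp add: q_def sum_distrib_left algebra_simps)
    also have "\<dots> = (\<Sum>S\<in>K. w S * (\<Sum>A\<in>Pow X. g A * walsh S A))"
      by (subst sum.swap) (simp add: sum_distrib_left)
    also have "\<dots> = (\<Sum>S\<in>K. w S * (N * w S))"
    proof (intro sum.cong refl)
      fix S assume "S \<in> K"
      then have "fourier X g S = w S" using fin i by (simp add: K_def g_def w_def fourier_laplacian)
      then show "w S * (\<Sum>A\<in>Pow X. g A * walsh S A) = w S * (N * w S)"
        using N by (simp add: fourier_def N_def[symmetric] field_simps)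
    qed
    finally show ?thesis by (simp add: \<sigma>_def sum_distrib_left power2_eq_square algebra_simps)
  qed
  \<comment> \<open>The square sum of \<open>q\<close> on the support of \<open>g\<close>.
    Cauchy-Schwarz and the fourth moment bound it, and \<open>12 * t \<le> 1\<close> makes the
    factor \<open>3 * t\<close> at most 1/4.\<close>
  define P where "P = (\<Sum>A\<in>Pow X. (g A)\<^sup>2 * (q A)\<^sup>2)"
  have "P\<^sup>2 \<le> (\<Sum>A\<in>Pow X. ((g A)\<^sup>2)\<^sup>2) * (\<Sum>A\<in>Pow X. ((q A)\<^sup>2)\<^sup>2)"
    unfolding P_def by (rule Cauchy_Schwarz_ineq_sum)
  also have "\<dots> \<le> (N * t) * (3 * N * \<sigma>\<^sup>2)"
    unfolding gg g2 using q4 N by (intro mult_left_mono) (auto simp: t_def)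
  also have "\<dots> = (3 * t) * (N * \<sigma>)\<^sup>2" by (simp add: power2_eq_square)
  also have "\<dots> \<le> (1 / 4) * (N * \<sigma>)\<^sup>2" using t by (intro mult_right_mono) auto
  also have "\<dots> = (N * \<sigma> / 2)\<^sup>2" by (simp add: power2_eq_square)
  finally have P: "P \<le> N * \<sigma> / 2"
    by (rule power2_le_imp_le) (use N in \<open>auto simp: \<sigma>_def sum_nonneg\<close>)
  \<comment> \<open>As \<open>g\<close> equals its own cube, \<open>q\<close> can be cut down to the
    support of \<open>g\<close> before Cauchy-Schwarz, which yields \<open>P\<close> instead of the
    full square sum.\<close>
  have "(N * \<sigma>)\<^sup>2 = (\<Sum>A\<in>Pow X. g A * (g A * q A * g A))\<^sup>2"
    unfolding gq[symmetric] by (intro arg_cong[where f = "\<lambda>x. x\<^sup>2"] sum.cong refl)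
      (metis gg(1) mult.assoc mult.commute power2_eq_square)
  also have "\<dots> \<le> (\<Sum>A\<in>Pow X. (g A)\<^sup>2) * (\<Sum>A\<in>Pow X. (g A * q A * g A)\<^sup>2)"
    by (rule Cauchy_Schwarz_ineq_sum)
  also have "(\<Sum>A\<in>Pow X. (g A * q A * g A)\<^sup>2) = P"
  proof -
    have "(g A * q A * g A)\<^sup>2 = ((g A)\<^sup>2)\<^sup>2 * (q A)\<^sup>2" for A by algebra
    then show ?thesis unfolding P_def gg by simp
  qed
  also have "(\<Sum>A\<in>Pow X. (g A)\<^sup>2) * P \<le> N * t * (N * \<sigma> / 2)"
    unfolding g2 using P N by (intro mult_left_mono) (auto simp: t_def)
  finally have "N\<^sup>2 * \<sigma> * \<sigma> \<le> N\<^sup>2 * \<sigma> * (t / 2)" by (simp add: power2_eq_square algebra_simps)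
  moreover have "\<sigma> \<ge> 0" by (simp add: \<sigma>_def sum_nonneg)
  moreover have "t \<ge> 0" by (simp add: t_def)
  ultimately have "\<sigma> \<le> t / 2" using N by (cases "\<sigma> = 0") auto
  then show ?thesis by (simp add: \<sigma>_def K_def w_def)
qed

section \<open>Total influence and the upward boundary\<close>

lemma total_influence:
  assumes fin: "finite X"
  shows "(\<Sum>S\<in>Pow X. card S * (fourier X (sign F) S)\<^sup>2) = (\<Sum>i\<in>X. 2 * card (edge_boundary X F i) / 2 ^ card X)"
proof -
  have "(\<Sum>i\<in>X. 2 * card (edge_boundary X F i) / 2 ^ card X)
    = (\<Sum>i\<in>X. \<Sum>S\<in>Pow X. if i \<in> S then (fourier X (sign F) S)\<^sup>2 else 0)"
    using fin by (intro sum.cong) (simp_all add: influence_fourier sum.inter_filter del: Pow_iff of_nat_mult)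
  also have "\<dots> = (\<Sum>S\<in>Pow X. \<Sum>i\<in>X. if i \<in> S then (fourier X (sign F) S)\<^sup>2 else 0)"
    by (rule sum.swap)
  also have "\<dots> = (\<Sum>S\<in>Pow X. card S * (fourier X (sign F) S)\<^sup>2)"
  proof (intro sum.cong refl)
    fix S assume "S \<in> Pow X"
    then have "X \<inter> {i. i \<in> S} = S" by auto
    then show "(\<Sum>i\<in>X. if i \<in> S then (fourier X (sign F) S)\<^sup>2 else 0) = card S * (fourier X (sign F) S)\<^sup>2"
      using fin by (simp add: sum.If_cases)
  qed
  finally show ?thesis ..
qed

lemma parseval_sign: "finite X \<Longrightarrow> (\<Sum>S\<in>Pow X. (fourier X (sign F) S)\<^sup>2) = 1"
proof -
  have "(sign F A)\<^sup>2 = 1" for A by (simp add: sign_def)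
  then show "finite X \<Longrightarrow> (\<Sum>S\<in>Pow X. (fourier X (sign F) S)\<^sup>2) = 1"
    by (simp add: parseval card_Pow)
qed

text \<open>
  Total influence plus the level-one coefficients counts only upward edges. Since \<open>0 \<le> w
  \<le> 1\<close> gives \<open>w\<^sup>2 \<le> w\<close> for these coefficients, level one is
  weighted at least twice, just as level two is.
\<close>

lemma up_boundary_lower_bound:
  fixes F :: "'a set set"
  assumes fin: "finite X"
    and nonneg: "\<And>i. i \<in> X \<Longrightarrow> fourier X (sign F) {i} \<ge> 0"
  defines "W \<equiv> \<lambda>S. (fourier X (sign F) S)\<^sup>2"
  shows "2 * (1 - W {}) + (\<Sum>S\<in>{S \<in> Pow X. card S \<ge> 3}. (real (card S) - 2) * W S)
    \<le> 4 * (\<Sum>i\<in>X. card (up_boundary X F i)) / 2 ^ card X"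
proof -
  have Wsum: "(\<Sum>S\<in>Pow X. W S) = 1" unfolding W_def using fin by (rule parseval_sign)
  have W0: "W S \<ge> 0" for S by (simp add: W_def)
  have le1: "W {i} \<le> fourier X (sign F) {i}" if "i \<in> X" for i
  proof -
    have "W {i} \<le> (\<Sum>S\<in>Pow X. W S)" using that fin W0 by (intro member_le_sum) auto
    then have "(fourier X (sign F) {i})\<^sup>2 \<le> 1" unfolding Wsum by (simp add: W_def)
    then have "fourier X (sign F) {i} \<le> 1" using power2_le_imp_le[of "fourier X (sign F) {i}" 1] by simp
    then show ?thesis unfolding W_def power2_eq_square
      using nonneg[OF that] by (simp add: mult_left_le)
  qed
  have single: "(\<Sum>i\<in>X. W {i}) = (\<Sum>S\<in>Pow X. if card S = 1 then W S else 0)"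
  proof -
    have "(\<Sum>S\<in>Pow X. if card S = 1 then W S else 0) = (\<Sum>S\<in>{S \<in> Pow X. card S = 1}. W S)"
      using fin by (simp add: sum.inter_filter del: Pow_iff)
    also have "{S \<in> Pow X. card S = 1} = (\<lambda>i. {i}) ` X"
      by (auto simp: card_1_singleton_iff)
    also have "(\<Sum>S\<in>(\<lambda>i. {i}) ` X. W S) = (\<Sum>i\<in>X. W {i})"
      by (simp add: sum.reindex)
    finally show ?thesis ..
  qed
  have "2 * (1 - W {}) + (\<Sum>S\<in>{S \<in> Pow X. card S \<ge> 3}. (real (card S) - 2) * W S)
    = (\<Sum>S\<in>Pow X. 2 * W S - 2 * (if S = {} then W S else 0)
        + (if card S \<ge> 3 then (real (card S) - 2) * W S else 0))"
  proof -
    have "(\<Sum>S\<in>Pow X. if S = {} then W S else 0) = W {}"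
      using fin by (simp add: sum.delta)
    then show ?thesis using fin Wsum
      by (simp add: sum.distrib sum_subtractf sum.inter_filter del: Pow_iff flip: sum_distrib_left)
  qed
  \<comment> \<open>Level by level: level one counts \<open>1 + 1\<close>, level two counts 2, and a
    level \<open>k \<ge> 3\<close> counts \<open>2 + (k - 2)\<close>.\<close>
  also have "\<dots> = (\<Sum>S\<in>Pow X. card S * W S + (if card S = 1 then W S else 0))"
  proof (intro sum.cong refl)
    fix S assume "S \<in> Pow X"
    then have "S = {} \<longleftrightarrow> card S = 0" using fin by (auto simp: finite_subset)
    moreover consider "card S = 0" | "card S = 1" | "card S = 2" | "card S \<ge> 3" by linarith
    ultimately show "2 * W S - 2 * (if S = {} then W S else 0)
        + (if card S \<ge> 3 then (real (card S) - 2) * W S else 0)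
      = card S * W S + (if card S = 1 then W S else 0)"
      by cases (auto simp: algebra_simps)
  qed
  also have "\<dots> = (\<Sum>i\<in>X. 2 * card (edge_boundary X F i) / 2 ^ card X + W {i})"
    using total_influence[OF fin, of F] unfolding sum.distrib single[symmetric] by (simp add: W_def)
  also have "\<dots> \<le> (\<Sum>i\<in>X. 2 * card (edge_boundary X F i) / 2 ^ card X + fourier X (sign F) {i})"
    using le1 by (intro sum_mono) auto
  also have "\<dots> = (\<Sum>i\<in>X. 4 * card (up_boundary X F i) / 2 ^ card X)"
    using fin by (intro sum.cong) (simp_all add: fourier_singleton card_edge_boundary field_simps)
  also have "\<dots> = 4 * (\<Sum>i\<in>X. card (up_boundary X F i)) / 2 ^ card X"
    by (simp add: sum_distrib_left flip: sum_divide_distrib)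
  finally show ?thesis .
qed

lemma fourier_empty:
  assumes "finite X" "F \<subseteq> Pow X"
  shows "fourier X (sign F) {} = 2 * card F / 2 ^ card X - 1"
proof -
  have "(\<Sum>A\<in>Pow X. sign F A) = (\<Sum>A\<in>Pow X. 2 * (if A \<in> F then 1 else 0) - 1)"
    by (intro sum.cong) (auto simp: sign_def)
  also have "\<dots> = 2 * real (card F) - 2 ^ card X"
    using assms by (simp add: sum_subtractf card_Pow sum.If_cases Int_absorb1 flip: sum_distrib_left)
  finally show ?thesis by (simp add: fourier_def diff_divide_distrib)
qed

section \<open>Approximation by a junta\<close>

text \<open>\<open>J\<close> collects the coordinates of influence above 1/12. Every other
  coordinate has at least half of its influence on levels three and up, by
  \<open>low_degree_weight_le\<close>, and the total influence from those levels is at most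
  \<open>12 * \<delta>\<close>.\<close>

lemma low_influence_outside_junta:
  assumes fin: "finite X" and FX: "F \<subseteq> Pow X" and uc: "union_closed F"
    and nonneg: "\<And>i. i \<in> X \<Longrightarrow> fourier X (sign F) {i} \<ge> 0"
    and \<delta>: "real (card F) = (1 - \<delta>) / 2 * 2 ^ card X" "0 \<le> \<delta>" "\<delta> \<le> 1"
  shows "\<exists>J\<subseteq>X. card J \<le> 48 \<and> (\<Sum>i\<in>X - J. real (card (edge_boundary X F i))) \<le> 12 * \<delta> * 2 ^ card X"
proof -
  define N where "N = (2::real) ^ card X"
  define t where "t i = 2 * card (edge_boundary X F i) / N" for i
  define W where "W S = (fourier X (sign F) S)\<^sup>2" for S
  define \<sigma> where "\<sigma> i = (\<Sum>S\<in>{S \<in> Pow X. i \<in> S \<and> card S \<le> 2}. W S)" for i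
  define J where "J = {i \<in> X. 12 * t i > 1}"
  have N: "N > 0" by (simp add: N_def)
  have W0: "W S \<ge> 0" for S by (simp add: W_def)
  have JX: "J \<subseteq> X" by (auto simp: J_def)
  have We: "W {} = \<delta>\<^sup>2"
    using fourier_empty[OF fin FX] \<delta>(1) by (simp add: W_def power2_eq_square)
  have up: "4 * (\<Sum>i\<in>X. card (up_boundary X F i)) / N \<le> 2 + 2 * \<delta>"
  proof -
    have "card (Pow X - F) + card F = 2 ^ card X"
      using fin FX by (simp add: card_Diff_subset finite_subset card_Pow card_mono flip: card_Pow)
    then have "real (card (Pow X - F)) + real (card F) = N"
      unfolding N_def by (metis of_nat_add of_nat_numeral of_nat_power)
    then have "4 * real (card (Pow X - F)) = (2 + 2 * \<delta>) * N"
      using \<delta>(1) unfolding N_def[symmetric] by (simp add: field_simps)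
    moreover have "real (\<Sum>i\<in>X. card (up_boundary X F i)) \<le> real (card (Pow X - F))"
      using sum_card_up_boundary_le[OF fin uc] of_nat_mono by blast
    ultimately show ?thesis using N by (simp add: field_simps)
  qed
  \<comment> \<open>The two bounds on the upward boundary leave at most
    \<open>2 * \<delta> + 2 * \<delta>\<^sup>2 \<le> 4 * \<delta>\<close> for the weights
    \<open>card S - 2\<close>. The remaining factor 3 comes from
    \<open>card S \<le> 3 * (card S - 2)\<close>.\<close>
  have tail: "(\<Sum>S\<in>{S \<in> Pow X. card S \<ge> 3}. card S * W S) \<le> 12 * \<delta>"
  proof -
    have "(\<Sum>S\<in>{S \<in> Pow X. card S \<ge> 3}. card S * W S)
      \<le> (\<Sum>S\<in>{S \<in> Pow X. card S \<ge> 3}. 3 * ((real (card S) - 2) * W S))"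
    proof (intro sum_mono)
      fix S assume "S \<in> {S \<in> Pow X. card S \<ge> 3}"
      then have "card S * W S \<le> (3 * (real (card S) - 2)) * W S"
        using W0 by (intro mult_right_mono) auto
      then show "card S * W S \<le> 3 * ((real (card S) - 2) * W S)" by (simp add: algebra_simps)
    qed
    also have "\<dots> \<le> 3 * (2 * \<delta> + 2 * \<delta>\<^sup>2)"
      using up_boundary_lower_bound[OF fin nonneg] up We
      unfolding sum_distrib_left[symmetric] W_def N_def by auto
    also have "\<dots> \<le> 3 * (2 * \<delta> + 2 * \<delta>)"
      using \<delta> by (simp add: power2_eq_square mult_left_le)
    finally show ?thesis by simp
  qed
  have t_split: "t i = \<sigma> i + (\<Sum>S\<in>Pow X. if i \<in> S \<and> card S \<ge> 3 then W S else 0)" if "i \<in> X" for i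
  proof -
    have "{S \<in> Pow X. i \<in> S} = {S \<in> Pow X. i \<in> S \<and> card S \<le> 2} \<union> {S \<in> Pow X. i \<in> S \<and> card S \<ge> 3}"
      "{S \<in> Pow X. i \<in> S \<and> card S \<le> 2} \<inter> {S \<in> Pow X. i \<in> S \<and> card S \<ge> 3} = {}"
      by auto
    then have "(\<Sum>S\<in>{S \<in> Pow X. i \<in> S}. W S) = \<sigma> i + (\<Sum>S\<in>{S \<in> Pow X. i \<in> S \<and> card S \<ge> 3}. W S)"
      using fin unfolding \<sigma>_def by (simp add: sum.union_disjoint)
    moreover have "t i = (\<Sum>S\<in>{S \<in> Pow X. i \<in> S}. W S)"
      using influence_fourier[OF fin that, of F] unfolding t_def N_def W_def by simp
    ultimately show ?thesis
      using fin by (simp add: sum.inter_filter del: Pow_iff)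
  qed
  have tail_i: "(\<Sum>i\<in>X. t i - \<sigma> i) \<le> 12 * \<delta>"
  proof -
    have "(\<Sum>i\<in>X. t i - \<sigma> i) = (\<Sum>i\<in>X. \<Sum>S\<in>Pow X. if i \<in> S \<and> card S \<ge> 3 then W S else 0)"
      by (simp add: t_split)
    also have "\<dots> = (\<Sum>S\<in>Pow X. \<Sum>i\<in>X. if i \<in> S \<and> card S \<ge> 3 then W S else 0)"
      by (rule sum.swap)
    also have "\<dots> = (\<Sum>S\<in>Pow X. if card S \<ge> 3 then card S * W S else 0)"
    proof (intro sum.cong refl)
      fix S assume "S \<in> Pow X"
      then have "X \<inter> {i. i \<in> S} = S" by auto
      then show "(\<Sum>i\<in>X. if i \<in> S \<and> card S \<ge> 3 then W S else 0) = (if card S \<ge> 3 then card S * W S else 0)"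
        using fin by (simp add: sum.If_cases)
    qed
    also have "\<dots> = (\<Sum>S\<in>{S \<in> Pow X. card S \<ge> 3}. card S * W S)"
      using fin by (simp add: sum.inter_filter del: Pow_iff)
    finally show ?thesis using tail by simp
  qed
  have \<sigma>_le: "\<sigma> i \<le> t i" if "i \<in> X" for i
    using t_split[OF that] W0 by (auto intro: sum_nonneg)
  have "(\<Sum>i\<in>X - J. t i) \<le> (\<Sum>i\<in>X - J. 2 * (t i - \<sigma> i))"
  proof (intro sum_mono)
    fix i assume i: "i \<in> X - J"
    then have "\<sigma> i \<le> t i / 2"
      using low_degree_weight_le[OF fin, of i F]
      by (auto simp: J_def t_def N_def \<sigma>_def W_def)
    then show "t i \<le> 2 * (t i - \<sigma> i)" by simp
  qed
  also have "\<dots> \<le> (\<Sum>i\<in>X. 2 * (t i - \<sigma> i))"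
    using fin \<sigma>_le by (intro sum_mono2) auto
  also have "\<dots> \<le> 24 * \<delta>" using tail_i unfolding sum_distrib_left[symmetric] by simp
  finally have "(\<Sum>i\<in>X - J. real (card (edge_boundary X F i))) * 2 / N \<le> 24 * \<delta>"
    by (simp add: t_def sum_distrib_left mult.commute flip: sum_divide_distrib)
  then have 1: "(\<Sum>i\<in>X - J. real (card (edge_boundary X F i))) \<le> 12 * \<delta> * N"
    using N by (simp add: field_simps)
  \<comment> \<open>Adding the nonnegative level-one coefficients to the influences gives the upward
    count, at most 4; the threshold 1/12 then gives 48.\<close>
  have "card J * (1 / 12) \<le> (\<Sum>i\<in>J. t i)"
    by (rule sum_bounded_below) (auto simp: J_def)
  also have "\<dots> \<le> (\<Sum>i\<in>X. t i)"
    using fin JX by (intro sum_mono2) (auto simp: t_def N_def)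
  also have "\<dots> \<le> (\<Sum>i\<in>X. t i + fourier X (sign F) {i})"
    using nonneg by (intro sum_mono) auto
  also have "\<dots> = (\<Sum>i\<in>X. 4 * card (up_boundary X F i) / N)"
    using fin N by (intro sum.cong) (simp_all add: t_def N_def fourier_singleton card_edge_boundary field_simps)
  also have "\<dots> = 4 * (\<Sum>i\<in>X. card (up_boundary X F i)) / N"
    by (simp add: sum_distrib_left flip: sum_divide_distrib)
  also have "\<dots> \<le> 4" using up \<delta> by simp
  finally have "card J \<le> 48" by simp
  then show ?thesis using JX 1 by (auto simp: N_def)
qed

section \<open>Fibers over a set of coordinates\<close>

definition fiber :: "'a set \<Rightarrow> 'a set \<Rightarrow> 'a set set \<Rightarrow> 'a set \<Rightarrow> 'a set set" where
  "fiber X J F u = {y \<in> Pow (X - J). u \<union> y \<in> F}"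

definition majority :: "'a set \<Rightarrow> 'a set \<Rightarrow> 'a set set \<Rightarrow> 'a set set" where
  "majority X J F = {u \<in> Pow J. 2 * card (fiber X J F u) > 2 ^ card (X - J)}"

text \<open>The number of points at which the fiber over \<open>u\<close> disagrees with its
  majority vote; in a tie both votes give the same number.\<close>

definition minority_size :: "'a set \<Rightarrow> 'a set \<Rightarrow> 'a set set \<Rightarrow> 'a set \<Rightarrow> nat" where
  "minority_size X J F u = min (card (fiber X J F u)) (2 ^ card (X - J) - card (fiber X J F u))"

lemma card_fiber_le: "finite X \<Longrightarrow> card (fiber X J F u) \<le> 2 ^ card (X - J)"
  unfolding fiber_def by (metis (no_types, lifting) Pow_iff card_Pow card_mono finite_Diff finite_Pow_iff mem_Collect_eq subsetI)

text \<open>\<open>min_card_le_boundary\<close> is applied in each fiber. An edge in a direction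
  outside \<open>J\<close> stays within one fiber, so no edge is counted twice.\<close>

lemma sum_minority_size_le:
  assumes "finite X" "J \<subseteq> X"
  shows "(\<Sum>u\<in>Pow J. minority_size X J F u) \<le> (\<Sum>i\<in>X - J. card (edge_boundary X F i))"
proof -
  have fin: "finite (X - J)" "finite (Pow J)" using assms by (auto intro: finite_subset)
  have "minority_size X J F u \<le> (\<Sum>i\<in>X - J. card (edge_boundary (X - J) (fiber X J F u) i))" for u
  proof -
    have "fiber X J F u \<inter> Pow (X - J) = fiber X J F u" by (auto simp: fiber_def)
    then show ?thesis
      using min_card_le_boundary[OF fin(1), of "fiber X J F u"] by (simp add: minority_size_def)
  qed
  then have "(\<Sum>u\<in>Pow J. minority_size X J F u)
    \<le> (\<Sum>u\<in>Pow J. \<Sum>i\<in>X - J. card (edge_boundary (X - J) (fiber X J F u) i))"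
    by (intro sum_mono)
  also have "\<dots> = (\<Sum>i\<in>X - J. \<Sum>u\<in>Pow J. card (edge_boundary (X - J) (fiber X J F u) i))"
    by (rule sum.swap)
  also have "\<dots> \<le> (\<Sum>i\<in>X - J. card (edge_boundary X F i))"
  proof (rule sum_mono)
    fix i assume i: "i \<in> X - J"
    have "(\<Sum>u\<in>Pow J. card (edge_boundary (X - J) (fiber X J F u) i))
      = card (SIGMA u:Pow J. edge_boundary (X - J) (fiber X J F u) i)"
      using fin by simp
    also have "\<dots> \<le> card (edge_boundary X F i)"
    proof (rule card_inj_on_le)
      show "inj_on (\<lambda>(u, y). u \<union> y) (SIGMA u:Pow J. edge_boundary (X - J) (fiber X J F u) i)"
      proof (rule inj_onI, clarify)
        fix u y v z
        assume "u \<subseteq> J" "v \<subseteq> J" "y \<in> edge_boundary (X - J) (fiber X J F u) i"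
          "z \<in> edge_boundary (X - J) (fiber X J F v) i" and eq: "u \<union> y = v \<union> z"
        then have "u = (u \<union> y) \<inter> J" "v = (v \<union> z) \<inter> J" "y = (u \<union> y) - J" "z = (v \<union> z) - J"
          by (auto simp: edge_boundary_def)
        then show "u = v \<and> y = z" using eq by metis
      qed
      show "(\<lambda>(u, y). u \<union> y) ` (SIGMA u:Pow J. edge_boundary (X - J) (fiber X J F u) i) \<subseteq> edge_boundary X F i"
        using i assms by (auto simp: edge_boundary_def fiber_def)
    qed (use assms in simp)
    finally show "(\<Sum>u\<in>Pow J. card (edge_boundary (X - J) (fiber X J F u) i)) \<le> card (edge_boundary X F i)" .
  qed
  finally show ?thesis .
qed

text \<open>A character with \<open>S \<subseteq> J\<close> is constant on fibers. Passing to the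
  lift of the majority family flips the sign only at minority points, and each flip changes the sum
  by 2 in absolute value.\<close>

lemma fourier_majority:
  assumes "finite X" "J \<subseteq> X" "S \<subseteq> J"
  shows "\<bar>fourier X (sign F) S - fourier J (sign (majority X J F)) S\<bar>
    \<le> 2 * (\<Sum>u\<in>Pow J. minority_size X J F u) / 2 ^ card X"
proof -
  define M where "M = (2::real) ^ card (X - J)"
  have fin: "finite (X - J)" "finite J" using assms by (auto intro: finite_subset)
  have "card X = card (X - J) + card J"
    using assms by (metis card_Diff_subset card_mono fin(2) le_add_diff_inverse2)
  then have N: "2 ^ card X = M * 2 ^ card J" by (simp add: M_def power_add)
  have M: "M > 0" by (simp add: M_def)
  have inner: "(\<Sum>y\<in>Pow (X - J). sign F (u \<union> y)) = 2 * real (card (fiber X J F u)) - M" for u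
  proof -
    have "(\<Sum>y\<in>Pow (X - J). sign F (u \<union> y)) = (\<Sum>y\<in>Pow (X - J). 2 * (if u \<union> y \<in> F then 1 else 0) - 1)"
      by (intro sum.cong) (auto simp: sign_def)
    moreover have "Pow (X - J) \<inter> {y. u \<union> y \<in> F} = fiber X J F u" by (auto simp: fiber_def)
    ultimately show ?thesis
      using fin by (simp add: sum_subtractf card_Pow sum.If_cases M_def flip: sum_distrib_left)
  qed
  have err: "\<bar>(\<Sum>y\<in>Pow (X - J). sign F (u \<union> y)) - M * sign (majority X J F) u\<bar> = 2 * minority_size X J F u"
    if "u \<in> Pow J" for u
  proof -
    have "real (card (fiber X J F u)) \<le> M"
      using card_fiber_le[OF assms(1), of J F u] of_nat_mono[of "card (fiber X J F u)" "2 ^ card (X - J)"]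
      by (simp add: M_def)
    moreover have "u \<in> majority X J F \<longleftrightarrow> 2 * real (card (fiber X J F u)) > M"
    proof -
      have "u \<in> majority X J F \<longleftrightarrow> 2 ^ card (X - J) < 2 * card (fiber X J F u)"
        using that by (simp add: majority_def)
      also have "\<dots> \<longleftrightarrow> real (2 ^ card (X - J)) < real (2 * card (fiber X J F u))"
        by (simp only: of_nat_less_iff)
      finally show ?thesis by (simp add: M_def)
    qed
    moreover have "real (minority_size X J F u) = min (real (card (fiber X J F u))) (M - real (card (fiber X J F u)))"
      using card_fiber_le[OF assms(1), of J F u] by (simp add: minority_size_def M_def of_nat_diff of_nat_min)
    ultimately show ?thesis unfolding inner by (auto simp: sign_def)
  qed
  have chi: "walsh S (u \<union> y) = walsh S u" if "y \<in> Pow (X - J)" for u y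
  proof -
    have "S \<inter> (u \<union> y) = S \<inter> u" using that assms(3) by auto
    then show ?thesis by (simp add: walsh_def)
  qed
  have "(\<Sum>A\<in>Pow X. sign F A * walsh S A) = (\<Sum>u\<in>Pow J. (\<Sum>y\<in>Pow (X - J). sign F (u \<union> y)) * walsh S u)"
    unfolding sum_Pow_Un[OF assms(2)] sum_distrib_right by (intro sum.cong refl) (simp add: chi)
  then have "(\<Sum>A\<in>Pow X. sign F A * walsh S A) - M * (\<Sum>u\<in>Pow J. sign (majority X J F) u * walsh S u)
    = (\<Sum>u\<in>Pow J. ((\<Sum>y\<in>Pow (X - J). sign F (u \<union> y)) - M * sign (majority X J F) u) * walsh S u)"
    by (simp add: sum_distrib_left sum_subtractf left_diff_distrib mult.assoc)
  also have "\<bar>\<dots>\<bar> \<le> (\<Sum>u\<in>Pow J. \<bar>((\<Sum>y\<in>Pow (X - J). sign F (u \<union> y)) - M * sign (majority X J F) u) * walsh S u\<bar>)"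
    by (rule sum_abs)
  also have "\<dots> = (\<Sum>u\<in>Pow J. 2 * real (minority_size X J F u))"
  proof (intro sum.cong refl)
    fix u assume "u \<in> Pow J"
    moreover have "\<bar>walsh S u\<bar> = 1" by (simp add: walsh_def power_abs)
    ultimately show "\<bar>((\<Sum>y\<in>Pow (X - J). sign F (u \<union> y)) - M * sign (majority X J F) u) * walsh S u\<bar>
      = 2 * real (minority_size X J F u)"
      by (simp only: abs_mult err)
  qed
  finally have *: "\<bar>(\<Sum>A\<in>Pow X. sign F A * walsh S A) - M * (\<Sum>u\<in>Pow J. sign (majority X J F) u * walsh S u)\<bar>
    \<le> 2 * (\<Sum>u\<in>Pow J. real (minority_size X J F u))"
    by (simp add: sum_distrib_left)
  have "fourier X (sign F) S - fourier J (sign (majority X J F)) S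
    = ((\<Sum>A\<in>Pow X. sign F A * walsh S A) - M * (\<Sum>u\<in>Pow J. sign (majority X J F) u * walsh S u)) / 2 ^ card X"
    using M by (simp add: fourier_def N diff_divide_distrib)
  then show ?thesis using * by (simp add: abs_divide divide_right_mono)
qed

text \<open>Fibers over majority members have density above 3/4, so two of them share more than half
  of all \<open>y\<close>. A shared \<open>y\<close> lies in the fiber over
  \<open>u \<union> v\<close>, as \<open>(u \<union> y) \<union> (v \<union> y)\<close> is a
  member.\<close>

lemma union_closed_majority:
  assumes fin: "finite X" and uc: "union_closed F"
    and small: "\<And>u. u \<in> Pow J \<Longrightarrow> 4 * minority_size X J F u < 2 ^ card (X - J)"
  shows "union_closed (majority X J F)"
  unfolding union_closed_def
proof (intro ballI)
  fix u v assume uv: "u \<in> majority X J F" "v \<in> majority X J F"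
  have finY: "finite (fiber X J F w)" for w using fin by (simp add: fiber_def)
  have big: "4 * card (fiber X J F w) > 3 * 2 ^ card (X - J)" if "w \<in> majority X J F" for w
    using that small[of w] card_fiber_le[OF fin, of J F w]
    by (auto simp: majority_def minority_size_def min_def split: if_splits)
  have "card (fiber X J F u) + card (fiber X J F v)
    = card (fiber X J F u \<union> fiber X J F v) + card (fiber X J F u \<inter> fiber X J F v)"
    using finY finY by (rule card_Un_Int)
  moreover have "card (fiber X J F u \<union> fiber X J F v) \<le> card (Pow (X - J))"
    using fin by (intro card_mono) (auto simp: fiber_def)
  moreover have "card (fiber X J F u \<inter> fiber X J F v) \<le> card (fiber X J F (u \<union> v))"
  proof (intro card_mono finY subsetI)
    fix y assume "y \<in> fiber X J F u \<inter> fiber X J F v"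
    moreover have "(u \<union> y) \<union> (v \<union> y) = (u \<union> v) \<union> y" by auto
    ultimately show "y \<in> fiber X J F (u \<union> v)"
      using uc unfolding union_closed_def fiber_def by (metis (no_types, lifting) IntE mem_Collect_eq)
  qed
  ultimately have "2 * card (fiber X J F (u \<union> v)) > 2 ^ card (X - J)"
    using big[OF uv(1)] big[OF uv(2)] fin by (simp add: card_Pow)
  then show "u \<union> v \<in> majority X J F" using uv by (auto simp: majority_def)
qed

text \<open>Every set in \<open>B\<close> is a minority point of its own fiber.\<close>

lemma card_majority_fiber_complement_le:
  assumes fin: "finite X" and JX: "J \<subseteq> X"
    and B: "\<And>A. A \<in> B \<Longrightarrow> A \<subseteq> X \<and> A \<notin> F \<and> A \<inter> J \<in> majority X J F"
  shows "card B \<le> (\<Sum>u\<in>Pow J. minority_size X J F u)"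
proof -
  have finJ: "finite (Pow J)" using fin JX by (auto intro: finite_subset)
  let ?G = "SIGMA u:Pow J \<inter> majority X J F. Pow (X - J) - fiber X J F u"
  have "card B \<le> card ?G"
  proof (rule card_inj_on_le)
    show "inj_on (\<lambda>A. (A \<inter> J, A - J)) B" by (auto simp: inj_on_def)
    have "A \<inter> J \<union> (A - J) = A" for A by auto
    then show "(\<lambda>A. (A \<inter> J, A - J)) ` B \<subseteq> ?G" using B by (fastforce simp: fiber_def)
  qed (use fin finJ in auto)
  also have "\<dots> = (\<Sum>u\<in>Pow J \<inter> majority X J F. card (Pow (X - J) - fiber X J F u))"
    using fin finJ by simp
  also have "\<dots> = (\<Sum>u\<in>Pow J \<inter> majority X J F. minority_size X J F u)"
  proof (intro sum.cong refl)
    fix u assume u: "u \<in> Pow J \<inter> majority X J F"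
    have "fiber X J F u \<subseteq> Pow (X - J)" "finite (fiber X J F u)"
      using fin by (auto simp: fiber_def)
    then have "card (Pow (X - J) - fiber X J F u) = 2 ^ card (X - J) - card (fiber X J F u)"
      using fin by (simp add: card_Diff_subset card_Pow)
    then show "card (Pow (X - J) - fiber X J F u) = minority_size X J F u"
      using u by (auto simp: majority_def minority_size_def)
  qed
  also have "\<dots> \<le> (\<Sum>u\<in>Pow J. minority_size X J F u)"
    using finJ by (intro sum_mono2) auto
  finally show ?thesis .
qed

text \<open>The equality case of \<open>sum_card_up_boundary_le\<close>: the injection from leaving
  edges to non-members is onto.\<close>

lemma covers_member_if_up_boundary_maximal:
  assumes fin: "finite X" and uc: "union_closed F"
    and max: "card (Pow X - F) \<le> (\<Sum>i\<in>X. card (up_boundary X F i))"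
    and u: "u \<subseteq> X" "u \<notin> F"
  shows "\<exists>i\<in>u. u - {i} \<in> F"
proof -
  let ?f = "\<lambda>(i, A). insert i A" and ?G = "SIGMA i:X. up_boundary X F i"
  have "card (?f ` ?G) = (\<Sum>i\<in>X. card (up_boundary X F i))"
    using fin card_image[OF inj_on_insert_up_boundary[OF uc, of X X]] by simp
  moreover have "?f ` ?G \<subseteq> Pow X - F" by (auto simp: up_boundary_def)
  ultimately have "?f ` ?G = Pow X - F" using fin max by (intro card_seteq) auto
  moreover have "u \<in> Pow X - F" using u by simp
  ultimately have "u \<in> ?f ` ?G" by simp
  then obtain i A where "A \<in> up_boundary X F i" "u = insert i A" by auto
  then have "u - {i} = A" "A \<in> F" by (auto simp: up_boundary_def)
  then show ?thesis using \<open>u = insert i A\<close> by auto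
qed

section \<open>Large union-closed families\<close>

text \<open>Settles the case where \<open>T\<close> is the whole ground set and no outside element
  is left to average over. One element leaves only the excluded \<open>{{}}\<close>; two leave
  \<open>{{}, X}\<close>, where each element has exactly half frequency.\<close>

lemma extremal_family_not_strict:
  assumes fin: "finite X" and FX: "F \<subseteq> Pow X" and ne: "F \<noteq> {{}}" "X \<noteq> {}"
    and X2: "card X \<le> 2" and half: "2 * card F = 2 ^ card X"
    and notin: "\<And>A. A \<subseteq> X \<Longrightarrow> A \<notin> F \<Longrightarrow> card A = 1"
  shows "\<exists>i\<in>X. card (up_boundary X F i) \<le> card (up_boundary X (- F) i)"
proof -
  have emp: "{} \<in> F" using notin[of "{}"] by auto
  have finF: "finite F" using fin FX by (simp add: finite_subset)
  have "card X \<noteq> 0" using fin ne by simp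
  then consider "card X = 1" | "card X = 2" using X2 by linarith
  then show ?thesis
  proof cases
    case 1
    then have "card F = 1" using half by simp
    then show ?thesis using emp ne by (auto simp: card_1_singleton_iff)
  next
    case 2
    then have "X \<in> F" using notin[of X] by auto
    have "card {{}, X} = card F" using half 2 ne by auto
    then have F: "F = {{}, X}"
      using emp \<open>X \<in> F\<close> finF card_subset_eq[of F "{{}, X}"] by auto
    obtain i where i: "i \<in> X" using ne by auto
    have "up_boundary X F i \<subseteq> {{}}" using i by (auto simp: up_boundary_def F)
    then have "card (up_boundary X F i) \<le> 1" using card_mono[of "{{}}" "up_boundary X F i"] by simp
    moreover have "X - {i} \<in> up_boundary X (- F) i"
    proof -
      have "card (X - {i}) = 1" using 2 i fin by simp
      then have "X - {i} \<noteq> {}" by (metis card.empty zero_neq_one)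
      then show ?thesis using i by (auto simp: up_boundary_def F insert_absorb)
    qed
    then have "card (up_boundary X (- F) i) \<ge> 1"
      using fin by (metis One_nat_def Suc_leI card_gt_0_iff empty_iff finite_up_boundary)
    ultimately show ?thesis using i by (intro bexI[of _ i]) auto
  qed
qed

text \<open>For density \<open>\<mu>\<close>, the two bounds on the upward boundary give
  \<open>(2 * \<mu> - 1) * (1 - \<mu>) \<le> 0\<close>. Density above one half thus forces the full
  power set, which no edge leaves, against \<open>pos\<close>; for empty \<open>X\<close> it is the
  excluded \<open>{{}}\<close>.\<close>

lemma card_le_half:
  assumes fin: "finite X" and FX: "F \<subseteq> Pow X" and uc: "union_closed F" and ne: "F \<noteq> {{}}"
    and pos: "\<And>i. i \<in> X \<Longrightarrow> fourier X (sign F) {i} > 0"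
  shows "2 * real (card F) \<le> 2 ^ card X"
proof (rule ccontr)
  assume less: "\<not> ?thesis"
  define \<mu> where "\<mu> = real (card F) / 2 ^ card X"
  have "real (card (Pow X - F)) = (1 - \<mu>) * 2 ^ card X"
  proof -
    have "card (Pow X - F) + card F = 2 ^ card X"
      using fin FX by (simp add: card_Diff_subset finite_subset card_Pow card_mono flip: card_Pow)
    then have "real (card (Pow X - F)) + real (card F) = 2 ^ card X"
      by (metis of_nat_add of_nat_numeral of_nat_power)
    then have "real (card (Pow X - F)) = 2 ^ card X - real (card F)" by simp
    then show ?thesis by (simp add: \<mu>_def left_diff_distrib)
  qed
  have \<mu>: "\<mu> > 1 / 2" using less by (simp add: \<mu>_def field_simps)
  have "(\<Sum>S\<in>{S \<in> Pow X. card S \<ge> 3}. (real (card S) - 2) * (fourier X (sign F) S)\<^sup>2) \<ge> 0"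
    by (intro sum_nonneg) auto
  then have "2 * (1 - (fourier X (sign F) {})\<^sup>2) \<le> 4 * (\<Sum>i\<in>X. card (up_boundary X F i)) / 2 ^ card X"
    using up_boundary_lower_bound[OF fin, of F] pos by force
  also have "\<dots> \<le> 4 * card (Pow X - F) / 2 ^ card X"
    using sum_card_up_boundary_le[OF fin uc] by (intro divide_right_mono) (auto simp flip: of_nat_sum)
  also have "\<dots> = 4 * (1 - \<mu>)" using \<open>real (card (Pow X - F)) = _\<close> by simp
  finally have "2 * (1 - (2 * \<mu> - 1)\<^sup>2) \<le> 4 * (1 - \<mu>)"
    unfolding fourier_empty[OF fin FX] \<mu>_def by simp
  then have "(2 * \<mu> - 1) * (1 - \<mu>) \<le> 0" by (simp add: power2_eq_square algebra_simps)
  then have "1 - \<mu> \<le> 0" using \<mu> by (simp add: mult_le_0_iff)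
  then have "card (Pow X - F) = 0"
    using \<open>real (card (Pow X - F)) = _\<close> by (metis mult_nonneg_nonpos2 of_nat_le_0_iff zero_le_numeral zero_le_power mult.commute)
  then have F: "F = Pow X" using fin FX by auto
  have "X = {}"
  proof (rule ccontr)
    assume "X \<noteq> {}"
    then obtain i where i: "i \<in> X" by auto
    have "up_boundary X F i = {}" using i by (auto simp: up_boundary_def F)
    then have "fourier X (sign F) {i} \<le> 0"
      unfolding fourier_singleton[OF fin i] by (intro divide_nonpos_nonneg) auto
    then show False using pos[OF i] by simp
  qed
  then show False using F ne by simp
qed

text \<open>Multiplied by \<open>2 ^ card J\<close>, the coefficients of \<open>sign H\<close> are
  integers within 1/128 of those of \<open>sign F\<close>. Rounding makes the mean of
  \<open>sign H\<close> zero and its level one nonnegative. Then the lower bound on the upward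
  boundary of \<open>H\<close> reaches the number of non-members, and
  \<open>covers_member_if_up_boundary_maximal\<close> applies.\<close>

lemma majority_of_near_half_family:
  assumes fin: "finite X" and FX: "F \<subseteq> Pow X" and JX: "J \<subseteq> X" and uc: "union_closed F"
    and pos: "\<And>i. i \<in> X \<Longrightarrow> fourier X (sign F) {i} > 0"
    and mean: "\<bar>fourier X (sign F) {}\<bar> \<le> 1 / (4 * 2 ^ card J)"
    and small: "256 * (\<Sum>u\<in>Pow J. minority_size X J F u) \<le> 2 ^ card (X - J)"
  defines "H \<equiv> majority X J F"
  shows "union_closed H" "2 * card H = 2 ^ card J" "2 * card (Pow J - H) = 2 ^ card J"
    "\<And>u. u \<subseteq> J \<Longrightarrow> u \<notin> H \<Longrightarrow> \<exists>i\<in>u. u - {i} \<in> H"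
proof -
  let ?E = "\<Sum>u\<in>Pow J. minority_size X J F u"
  have finJ: "finite J" using fin JX by (rule finite_subset[rotated])
  have HJ: "H \<subseteq> Pow J" by (auto simp: H_def majority_def)
  show ucH: "union_closed H"
    unfolding H_def
  proof (rule union_closed_majority[OF fin uc])
    fix u assume "u \<in> Pow J"
    then have "minority_size X J F u \<le> ?E" using finJ by (intro member_le_sum) auto
    moreover have "(0::nat) < 2 ^ card (X - J)" by simp
    ultimately show "4 * minority_size X J F u < 2 ^ card (X - J)" using small by linarith
  qed
  have "card X = card (X - J) + card J"
    using fin JX finJ by (metis card_Diff_subset card_mono le_add_diff_inverse2)
  then have N: "(2::real) ^ card X = 2 ^ card (X - J) * 2 ^ card J" by (simp add: power_add)
  have "real (256 * ?E) \<le> real (2 ^ card (X - J))" using small of_nat_mono by blast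
  then have "256 * real ?E * 2 ^ card J \<le> 2 ^ card X" by (simp add: N)
  then have "2 * real ?E / 2 ^ card X \<le> 1 / (128 * 2 ^ card J)" by (simp add: field_simps)
  then have near: "\<bar>fourier X (sign F) S - fourier J (sign H) S\<bar> \<le> 1 / (128 * 2 ^ card J)" if "S \<subseteq> J" for S
    using fourier_majority[OF fin JX that, of F] unfolding H_def by linarith
  have "\<bar>fourier J (sign H) {}\<bar> \<le> 1 / (4 * 2 ^ card J) + 1 / (128 * 2 ^ card J)"
    using near[OF empty_subsetI] mean by linarith
  also have "\<dots> < 1 / 2 ^ card J" by (simp add: field_simps)
  also have "fourier J (sign H) {} = (2 * real (card H) - 2 ^ card J) / 2 ^ card J"
    unfolding fourier_empty[OF finJ HJ] by (simp add: diff_divide_distrib)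
  finally have "\<bar>2 * real (card H) - 2 ^ card J\<bar> < 1" by (simp add: abs_divide divide_less_cancel)
  then have "\<bar>int (2 * card H) - int (2 ^ card J)\<bar> < 1" 
    by (metis (mono_tags, lifting) of_int_abs of_int_diff of_int_less_1_iff of_int_of_nat_eq of_nat_mult of_nat_numeral of_nat_power)
  then show half: "2 * card H = 2 ^ card J" by linarith
  have "card (Pow J - H) + card H = 2 ^ card J"
    using finJ HJ by (simp add: card_Diff_subset finite_subset card_Pow card_mono flip: card_Pow)
  then show half': "2 * card (Pow J - H) = 2 ^ card J" using half by linarith
  have nonneg: "fourier J (sign H) {i} \<ge> 0" if i: "i \<in> J" for i
  proof -
    define k where "k = 2 * (int (card (up_boundary J H i)) - int (card (up_boundary J (- H) i)))"
    have k: "fourier J (sign H) {i} = k / 2 ^ card J"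
      using fourier_singleton[OF finJ i, of H] by (simp add: k_def)
    have "fourier X (sign F) {i} > 0" using pos JX i by auto
    then have "fourier J (sign H) {i} > - (1 / (128 * 2 ^ card J))"
      using near[of "{i}"] i by auto
    moreover have "- (1 / (128 * 2 ^ card J)) > - (1 / (2::real) ^ card J)" by (simp add: field_simps)
    ultimately have "real_of_int k / 2 ^ card J > - (1 / 2 ^ card J)" unfolding k by linarith
    then have "real_of_int k > - 1" by (simp add: field_simps)
    then have "k \<ge> 0" by linarith
    then show ?thesis unfolding k by simp
  qed
  have "(\<Sum>S\<in>{S \<in> Pow J. card S \<ge> 3}. (real (card S) - 2) * (fourier J (sign H) S)\<^sup>2) \<ge> 0"
    by (intro sum_nonneg) auto
  moreover have "fourier J (sign H) {} = 0"
  proof -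
    have "2 * real (card H) = 2 ^ card J"
      using half by (metis of_nat_mult of_nat_numeral of_nat_power)
    then show ?thesis unfolding fourier_empty[OF finJ HJ] by simp
  qed
  ultimately have "2 \<le> 4 * real (\<Sum>i\<in>J. card (up_boundary J H i)) / 2 ^ card J"
    using up_boundary_lower_bound[OF finJ nonneg] by auto
  then have "2 ^ card J \<le> 2 * real (\<Sum>i\<in>J. card (up_boundary J H i))" by (simp add: field_simps)
  then have "real (2 ^ card J) \<le> real (2 * (\<Sum>i\<in>J. card (up_boundary J H i)))" by simp
  then have "2 ^ card J \<le> 2 * (\<Sum>i\<in>J. card (up_boundary J H i))" using of_nat_le_iff by blast
  then have "card (Pow J - H) \<le> (\<Sum>i\<in>J. card (up_boundary J H i))" using half' by linarith
  then show "\<exists>i\<in>u. u - {i} \<in> H" if "u \<subseteq> J" "u \<notin> H" for u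
    using covers_member_if_up_boundary_maximal[OF finJ ucH] that by blast
qed

lemma large_union_closed_not_strict:
  assumes fin: "finite X" and FX: "F \<subseteq> Pow X" and uc: "union_closed F" and ne: "F \<noteq> {{}}"
    and large: "real (card F) \<ge> (1 / 2 - 1 / 2 ^ 64) * 2 ^ card X"
  shows "\<exists>i\<in>X. fourier X (sign F) {i} \<le> 0"
proof (rule ccontr)
  assume "\<not> ?thesis"
  then have pos: "fourier X (sign F) {i} > 0" if "i \<in> X" for i using that by force
  then have strict: "card (up_boundary X (- F) i) < card (up_boundary X F i)" if "i \<in> X" for i
    using fourier_singleton[OF fin that, of F] that by (fastforce simp: zero_less_divide_iff)
  define \<delta> where "\<delta> = 1 - 2 * real (card F) / 2 ^ card X"
  have card_F: "real (card F) = (1 - \<delta>) / 2 * 2 ^ card X" by (simp add: \<delta>_def)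
  have \<delta>0: "0 \<le> \<delta>" using card_le_half[OF fin FX uc ne pos] by (simp add: \<delta>_def)
  have \<delta>1: "\<delta> \<le> 1 / 2 ^ 63" using large by (simp add: \<delta>_def field_simps)
  obtain J where J: "J \<subseteq> X" "card J \<le> 48"
    and bd: "(\<Sum>i\<in>X - J. real (card (edge_boundary X F i))) \<le> 12 * \<delta> * 2 ^ card X"
    using low_influence_outside_junta[OF fin FX uc less_imp_le[OF pos] card_F \<delta>0] \<delta>1 by auto
  have finJ: "finite J" using fin J by (auto intro: finite_subset)
  let ?E = "\<Sum>u\<in>Pow J. minority_size X J F u" and ?H = "majority X J F"
  have J48: "(2::real) ^ card J \<le> 2 ^ 48" using J by (intro power_increasing) auto
  have cX: "card X = card (X - J) + card J"
    using fin J finJ by (metis card_Diff_subset card_mono le_add_diff_inverse2)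
  \<comment> \<open>The size of the constant is settled here:
    \<open>\<delta> \<le> 1 / 2 ^ 63\<close> against a factor \<open>2 ^ 48\<close> from
    \<open>J\<close> leaves \<open>12 / 2 ^ 15 = 3 / 8192\<close>, below 1/256.\<close>
  have small: "256 * ?E \<le> 2 ^ card (X - J)"
  proof -
    have "real ?E \<le> real (\<Sum>i\<in>X - J. card (edge_boundary X F i))"
      using sum_minority_size_le[OF fin J(1)] of_nat_mono by blast
    also have "\<dots> \<le> 12 * \<delta> * 2 ^ card X" using bd by simp
    also have "\<dots> \<le> 12 * (1 / 2 ^ 63) * (2 ^ card (X - J) * 2 ^ 48)"
      unfolding cX power_add using \<delta>0 \<delta>1 J48 by (intro mult_mono) auto
    finally have "8192 * real ?E \<le> 3 * 2 ^ card (X - J)" by simp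
    moreover have "(0::real) \<le> 2 ^ card (X - J)" by simp
    ultimately have "256 * real ?E \<le> 2 ^ card (X - J)" by linarith
    then have "real (256 * ?E) \<le> real (2 ^ card (X - J))" by simp
    then show ?thesis using of_nat_le_iff by blast
  qed
  have mean: "\<bar>fourier X (sign F) {}\<bar> \<le> 1 / (4 * 2 ^ card J)"
  proof -
    have "\<bar>fourier X (sign F) {}\<bar> = \<delta>" using \<delta>0 unfolding fourier_empty[OF fin FX] \<delta>_def by simp
    also have "\<dots> \<le> 1 / (4 * 2 ^ 48)" using \<delta>1 by simp
    also have "\<dots> \<le> 1 / (4 * 2 ^ card J)" using J48 by (intro divide_left_mono) auto
    finally show ?thesis .
  qed
  note H = majority_of_near_half_family[OF fin FX J(1) uc pos mean small]
  obtain T where T: "T \<subseteq> J" "T \<noteq> {}" "card T \<le> 2" "\<And>u. u \<subseteq> J \<Longrightarrow> u \<notin> ?H \<Longrightarrow> card (u \<inter> T) = 1"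
    using exact_structure[OF finJ H(1) H(4) H(3)] by blast
  define B where "B = {A \<in> Pow X. card (A \<inter> T) \<noteq> 1 \<and> A \<notin> F}"
  have BE: "card B \<le> ?E"
  proof (rule card_majority_fiber_complement_le[OF fin J(1)])
    fix A assume A: "A \<in> B"
    have "A \<inter> J \<inter> T = A \<inter> T" using T by auto
    then have "A \<inter> J \<in> ?H" using T(4)[of "A \<inter> J"] A by (auto simp: B_def)
    then show "A \<subseteq> X \<and> A \<notin> F \<and> A \<inter> J \<in> ?H" using A by (auto simp: B_def)
  qed
  have "2 ^ 8 * card B \<le> 256 * ?E" using BE by simp
  also have "\<dots> \<le> 2 ^ card (X - J)" by (rule small)
  also have "\<dots> \<le> 2 ^ card X" unfolding cX by (intro power_increasing) auto
  finally have B8: "2 ^ 8 * card B \<le> 2 ^ card X" .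
  have "(\<Sum>i\<in>X - T. card (up_boundary X F i)) \<le> (\<Sum>i\<in>X - T. card (up_boundary X (- F) i))"
    using up_boundary_le_down_boundary_near_extremal[OF fin uc _ T(3)] T(1) J(1) B8 unfolding B_def by auto
  moreover have "(\<Sum>i\<in>X - T. card (up_boundary X (- F) i)) < (\<Sum>i\<in>X - T. card (up_boundary X F i))" if "X - T \<noteq> {}"
    using fin that strict by (intro sum_strict_mono) auto
  \<comment> \<open>Strictness in every direction contradicts the averaged inequality unless
    \<open>X - T\<close> is empty; \<open>J\<close> lies between \<open>T\<close> and
    \<open>X\<close>.\<close>
  ultimately have XT: "X = T" "X = J" using T(1) J(1) by fastforce+
  \<comment> \<open>With \<open>X - J\<close> empty, \<open>small\<close> reads
    \<open>256 * ?E \<le> 1\<close>, so the natural number \<open>?E\<close> vanishes.\<close>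
  then have E0: "?E = 0" using small by simp
  then have "B = {}" using BE fin by (simp add: B_def)
  then have "card A = 1" if "A \<subseteq> X" "A \<notin> F" for A
    using that XT by (auto simp: B_def Int_absorb2)
  moreover have "2 * card F = 2 ^ card X"
  proof -
    have "fourier X (sign F) {} = fourier J (sign ?H) {}"
      using fourier_majority[OF fin J(1), of "{}" F] E0 by simp
    also have "\<dots> = 2 * real (card ?H) / 2 ^ card J - 1"
      by (subst fourier_empty[OF finJ]) (auto simp: majority_def)
    finally have "card F = card ?H" unfolding fourier_empty[OF fin FX] XT(2)[symmetric] by simp
    then show ?thesis using H(2) XT by simp
  qed
  ultimately obtain i where "i \<in> X" "card (up_boundary X F i) \<le> card (up_boundary X (- F) i)"
    using extremal_family_not_strict[OF fin FX ne] T(2,3) XT by auto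
  then show False using strict by fastforce
qed

text \<open>\<open>walsh {i}\<close> sums to zero over the cube, so only twice its sum over
  \<open>F\<close> remains. This turns a nonpositive coefficient into the required
  frequency.\<close>

lemma fourier_singleton_members:
  assumes fin: "finite X" and FX: "F \<subseteq> Pow X" and i: "i \<in> X"
  shows "fourier X (sign F) {i} = 2 * (real (card F) - 2 * card (members_containing F i)) / 2 ^ card X"
proof -
  have finF: "finite F" using fin FX by (simp add: finite_subset)
  have "(\<Sum>A\<in>Pow X. sign F A * walsh {i} A) = (\<Sum>A\<in>Pow X. 2 * (if A \<in> F then walsh {i} A else 0) - walsh {i} A)"
    by (intro sum.cong) (auto simp: sign_def)
  also have "\<dots> = 2 * (\<Sum>A\<in>F. walsh {i} A)"
    using fin FX i by (simp add: sum_subtractf sum_walsh sum.If_cases Int_absorb1 flip: sum_distrib_left)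
  also have "(\<Sum>A\<in>F. walsh {i} A) = (\<Sum>A\<in>F. 1 - 2 * (if i \<in> A then 1 else 0))"
    by (intro sum.cong) (auto simp: walsh_singleton)
  also have "\<dots> = real (card F) - 2 * card (members_containing F i)"
  proof -
    have "members_containing F i = F \<inter> {A. i \<in> A}" by (auto simp: members_containing_def)
    then show ?thesis using finF by (simp add: sum_subtractf sum.If_cases flip: sum_distrib_left)
  qed
  finally show ?thesis by (simp add: fourier_def)
qed

theorem theorem1p4:
  "\<exists>c::real. c > 0 \<and>
    (\<forall>(n::nat) (F :: nat set set).
      F \<subseteq> Pow {1..n} \<longrightarrow> union_closed F \<longrightarrow> F \<noteq> {{}} \<longrightarrow>
      real (card F) \<ge> (1 / 2 - c) * 2 ^ n \<longrightarrow>
      (\<exists>i\<in>{1..n}. real (card (members_containing F i)) \<ge> 1 / 2 * real (card F)))"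
proof (intro exI[of _ "1 / 2 ^ 64"] conjI allI impI)
  fix n :: nat and F :: "nat set set"
  assume F: "F \<subseteq> Pow {1..n}" "union_closed F" "F \<noteq> {{}}"
    "real (card F) \<ge> (1 / 2 - 1 / 2 ^ 64) * 2 ^ n"
  then obtain i where i: "i \<in> {1..n}" "fourier {1..n} (sign F) {i} \<le> 0"
    using large_union_closed_not_strict[OF _ F(1-3)] by fastforce
  have "2 * (real (card F) - 2 * card (members_containing F i)) / 2 ^ n \<le> 0"
    using i(2) fourier_singleton_members[OF _ F(1) i(1)] by simp
  then have "2 * (real (card F) - 2 * card (members_containing F i)) \<le> 0"
    by (metis divide_pos_pos not_le zero_less_numeral zero_less_power)
  then have "real (card (members_containing F i)) \<ge> 1 / 2 * real (card F)" by simp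
  then show "\<exists>i\<in>{1..n}. real (card (members_containing F i)) \<ge> 1 / 2 * real (card F)"
    using i by blast
qed simp

end
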